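(* Suppose $\|g(x)-g(y)\|\le\kappa\|x-y\|$ for all $x,y\in\mathbb{R}^d$ with $\kappa<1$, and $\|g'(x)-g'(y)\|\le\gamma\|x-y\|$ for all $x,y\in\mathbb{R}^d$ with $\gamma>0$. Let $\{x_t\}$ be generated by AAP($m$) with damping ratios satisfying $\beta_t\ge\beta>0$ for some $\beta$, and with $S_t$ and $Y_t$ of full column rank for all $t\ge 0$. Suppose there exist constants $T,M>0$ such that $\mathrm{cond}(S_t)\le M$ for all $t>T$, and constants $T',M'>0$ such that, for all $t\ge T'$, $J_t$ is invertible, $\sigma_{\min}(Y_t)\ge M'\|f_t\|$, and $J_tG_t$ has full column rank. Let $x^*$ be the fixed-point solution, i.e., $x^*=g(x^* )$. When $\|f_t\|$ converges to $0$, the asymptotic $q$-linear convergence factor of AAP satisfies $$\lim_{t\to\infty}\frac{\|f_{t+1}\|}{\|f_t\|}\le\left[(1-\beta)+\beta\kappa\right]\max_{\|v\|=1}\ \inf_{p\in\mathbb{P}_m}\|p(f'(x^* ))v\| ,$$ where $\mathbb{P}_m$ denotes the set of polynomials $p$ of degree at most $m$ with $p(0)=1$. Furthermore, when $f'(x^* )$ is symmetric and positive definite, then $$\lim_{t\to\infty}\frac{\|f_{t+1}\|}{\|f_t\|}\le 2\left[(1-\beta)+\beta\kappa\right]\left(\frac{\sqrt{\mathrm{cond}(f'(x^* ))}-1}{\sqrt{\mathrm{cond}(f'(x^* ))}+1}\right)^m .$$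
   Context: $g:\mathbb{R}^d\to\mathbb{R}^d$ is continuously differentiable, with Jacobian $g'$, and $f(x):=g(x)-x$, with Jacobian $f'$. $\|\cdot\|$ is the Euclidean norm for vectors and the induced 2-norm for matrices; $\mathrm{cond}$ is the 2-norm condition number (ratio of largest to smallest singular value); $\sigma_{\min}$ is the smallest singular value. AAP($m$) (Alternating Anderson-Picard method), with integer $1\le m\le d$, damping ratios $\beta_t\ge 0$ and starting point $x_0\in\mathbb{R}^d$: for $t=0,1,2,\dots$ set $x_t^0:=x_t$, $x_t^{\ell}:=g(x_t^{\ell-1})$ for $1\le\ell\le m$, $f_t^\ell:=f(x_t^\ell)$ for $0\le\ell\le m$, and $f_t:=f_t^0=f(x_t)$. Let $\alpha_t=(\alpha_t^0,\dots,\alpha_t^m)\in\mathbb{R}^{m+1}$ minimize $\|\sum_{\ell=0}^m\alpha^\ell f_t^\ell\|^2$ subject to $\sum_{\ell=0}^m\alpha^\ell=1$, and set $x_{t+1}:=(1-\beta_t)\sum_{\ell=0}^m\alpha_t^\ell x_t^\ell+\beta_t\sum_{\ell=0}^m\alpha_t^\ell g(x_t^\ell)$. $S_t:=[s_t^0,\dots,s_t^{m-1}]$ and $Y_t:=[y_t^0,\dots,y_t^{m-1}]$ in $\mathbb{R}^{d\times m}$, where $s_t^\ell:=x_t^{\ell+1}-x_t^\ell$ and $y_t^\ell:=f_t^{\ell+1}-f_t^\ell$. (Full column rank of $S_t$ forces $f_t=s_t^0\neq 0$.) $J_t:=f'(x_t)$ and $G_t:=[f_t,\ g'(x_t)f_t,\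 g'(x_t)^2f_t,\ \dots,\ g'(x_t)^{m-1}f_t]\in\mathbb{R}^{d\times m}$ (matrix powers).
   Formalization: Damping ratios are also assumed to satisfy β_t ≤ 1 (the claim fails for larger β_t); lim is read as limsup; in the second part f'(x* ) is symmetric with f'(x* ) or −f'(x* ) positive definite, since only −f'(x* ) can be. *)

theory Defs
  imports "HOL-Analysis.Analysis" "HOL-Computational_Algebra.Polynomial"
begin

section \<open>Matrices\<close>

text \<open>A matrix with \<open>d\<close> rows and \<open>m\<close> columns is an element of
  \<^typ>\<open>real ^ 'm ^ 'd\<close> with \<open>d = CARD('d)\<close> and \<open>m = CARD('m)\<close>. The order on \<open>'m\<close> only serves to
  number the columns \<open>0, \<dots>, m - 1\<close>; every \<open>m \<ge> 1\<close> is the cardinality of such a type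
  (for instance of the numeral types).\<close>

definition from_columns :: "(nat \<Rightarrow> real ^ 'd) \<Rightarrow> real ^ 'm::{finite,linorder} ^ 'd" where
  "from_columns c = (\<chi> i j. c (card {..<j}) $ i)"

definition full_column_rank :: "real ^ 'm ^ 'd \<Rightarrow> bool" where
  "full_column_rank A \<longleftrightarrow> rank A = CARD('m)"

definition opnorm2 :: "real ^ 'm ^ 'd \<Rightarrow> real" where
  "opnorm2 A = onorm (\<lambda>v. A *v v)"

text \<open>Square roots of the eigenvalues of \<open>A\<^sup>T A\<close>. These are the singular values of \<open>A\<close> provided
  that \<open>A\<close> has at least as many rows as columns, the only case considered here.\<close>

definition singular_values :: "real ^ 'm ^ 'd \<Rightarrow> real set" where
  "singular_values A =
     {\<sigma>. \<sigma> \<ge> 0 \<and> (\<exists>v. v \<noteq> 0 \<and> (transpose A ** A) *v v = \<sigma>\<^sup>2 *\<^sub>R v)}"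

definition sigma_min :: "real ^ 'm ^ 'd \<Rightarrow> real" where
  "sigma_min A = Min (singular_values A)"

definition sigma_max :: "real ^ 'm ^ 'd \<Rightarrow> real" where
  "sigma_max A = Max (singular_values A)"

definition cond2 :: "real ^ 'm ^ 'd \<Rightarrow> real" where
  "cond2 A = sigma_max A / sigma_min A"

definition symmetric_mat :: "real ^ 'd ^ 'd \<Rightarrow> bool" where
  "symmetric_mat A \<longleftrightarrow> transpose A = A"

definition pos_def_mat :: "real ^ 'd ^ 'd \<Rightarrow> bool" where
  "pos_def_mat A \<longleftrightarrow> (\<forall>v. v \<noteq> 0 \<longrightarrow> v \<bullet> (A *v v) > 0)"

text \<open>The overloaded operations \<open>(^)\<close> and \<open>(*)\<close> on \<^typ>\<open>real ^ 'd ^ 'd\<close> act entrywise, so powers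
  with respect to the matrix product are introduced separately.\<close>

primrec matrix_power :: "real ^ 'd ^ 'd \<Rightarrow> nat \<Rightarrow> real ^ 'd ^ 'd" where
  "matrix_power A 0 = mat 1"
| "matrix_power A (Suc k) = A ** matrix_power A k"

definition matrix_poly :: "real poly \<Rightarrow> real ^ 'd ^ 'd \<Rightarrow> real ^ 'd ^ 'd" where
  "matrix_poly p A = (\<Sum>k\<le>degree p. coeff p k *\<^sub>R matrix_power A k)"

definition residual_polys :: "nat \<Rightarrow> real poly set" where
  "residual_polys m = {p. degree p \<le> m \<and> poly p 0 = 1}"

definition max_inf_poly :: "nat \<Rightarrow> real ^ 'd ^ 'd \<Rightarrow> real" where
  "max_inf_poly m A =
     (SUP v \<in> sphere 0 1. INF p \<in> residual_polys m. norm (matrix_poly p A *v v))"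

text \<open>The supremum is a maximum: the inner infimum is upper semicontinuous in \<open>v\<close>.\<close>

lemma max_inf_poly_attained:
  fixes A :: "real ^ 'd ^ 'd"
    and m :: nat
  defines "\<phi> \<equiv> \<lambda>v. INF p \<in> residual_polys m. norm (matrix_poly p A *v v)"
  shows "\<exists>v. norm v = 1 \<and> \<phi> v = max_inf_poly m A \<and> (\<forall>w. norm w = 1 \<longrightarrow> \<phi> w \<le> \<phi> v)"
proof -
  let ?S = "sphere (0 :: real ^ 'd) 1"
  have one: "1 \<in> residual_polys m"
    by (simp add: residual_polys_def)
  have ne: "?S \<noteq> {}"
    by simp
  have bb: "bdd_below ((\<lambda>p. norm (matrix_poly p A *v v)) ` residual_polys m)" for v
    by (rule bdd_belowI[of _ 0]) auto
  have le1: "\<phi> v \<le> 1" if "v \<in> ?S" for v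
  proof -
    have "\<phi> v \<le> norm (matrix_poly 1 A *v v)"
      unfolding \<phi>_def by (rule cINF_lower[OF bb one])
    also have "\<dots> = 1"
      using that by (simp add: matrix_poly_def)
    finally show ?thesis .
  qed
  have ba: "bdd_above (\<phi> ` ?S)"
    by (rule bdd_aboveI[of _ 1]) (use le1 in auto)
  define s where "s = (SUP v \<in> ?S. \<phi> v)"
  define K where "K c = ?S \<inter> {v. c \<le> \<phi> v}" for c
  have iff: "c \<le> \<phi> v \<longleftrightarrow> (\<forall>p \<in> residual_polys m. c \<le> norm (matrix_poly p A *v v))" for c v
    unfolding \<phi>_def using one bb by (subst le_cINF_iff) auto
  have closed_K: "closed (K c)" for c
  proof -
    have "K c = ?S \<inter> (\<Inter>p \<in> residual_polys m. {v. c \<le> norm (matrix_poly p A *v v)})"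
      by (auto simp: K_def iff)
    moreover have "closed {v. c \<le> norm (matrix_poly p A *v v)}" for p
      by (intro closed_Collect_le continuous_intros)
    ultimately show ?thesis
      by (simp add: closed_INT closed_Int)
  qed
  have "?S \<inter> \<Inter>(K ` {..<s}) \<noteq> {}"
  proof (rule compact_imp_fip)
    fix F
    assume F: "finite F" "F \<subseteq> K ` {..<s}"
    then obtain C where C: "finite C" "C \<subseteq> {..<s}" "F = K ` C"
      by (meson finite_subset_image)
    define c where "c = Max (insert (s - 1) C)"
    have "c < s"
      using C by (auto simp: c_def)
    then obtain v where v: "v \<in> ?S" "c < \<phi> v"
      using less_cSUP_iff[OF ne ba] unfolding s_def by blast
    have "b \<le> c" if "b \<in> C" for b
      using C that by (simp add: c_def)
    then have "v \<in> ?S \<inter> \<Inter>F"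
      using v C by (fastforce simp: K_def)
    then show "?S \<inter> \<Inter>F \<noteq> {}"
      by blast
  qed (use closed_K in auto)
  then obtain v where v: "v \<in> ?S" "\<And>c. c < s \<Longrightarrow> c \<le> \<phi> v"
    unfolding K_def by blast
  have "s \<le> \<phi> v"
    using v(2) by (rule dense_le)
  moreover have up: "\<phi> w \<le> s" if "w \<in> ?S" for w
    unfolding s_def by (rule cSUP_upper[OF that ba])
  moreover have "s = max_inf_poly m A"
    by (simp add: s_def max_inf_poly_def \<phi>_def)
  ultimately show ?thesis
    using v(1) by (intro exI[of _ v]) (force intro: antisym)
qed

section \<open>The alternating Anderson-Picard method\<close>

definition residual :: "('a::real_vector \<Rightarrow> 'a) \<Rightarrow> 'a \<Rightarrow> 'a" where
  "residual g x = g x - x"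

definition picard :: "('a \<Rightarrow> 'a) \<Rightarrow> 'a \<Rightarrow> nat \<Rightarrow> 'a" where
  "picard g x l = (g ^^ l) x"

text \<open>Only the values of the weights \<open>\<alpha>\<close> on \<open>{..m}\<close> matter. The starting point is \<open>x 0\<close>.\<close>

definition optimal_weights :: "nat \<Rightarrow> ('a::real_normed_vector \<Rightarrow> 'a) \<Rightarrow> 'a \<Rightarrow> (nat \<Rightarrow> real) \<Rightarrow> bool" where
  "optimal_weights m g x \<alpha> \<longleftrightarrow>
     is_arg_min (\<lambda>\<alpha>. (norm (\<Sum>l\<le>m. \<alpha> l *\<^sub>R residual g (picard g x l)))\<^sup>2)
       (\<lambda>\<alpha>. (\<Sum>l\<le>m. \<alpha> l) = 1) \<alpha>"

definition AAP :: "nat \<Rightarrow> ('a::real_normed_vector \<Rightarrow> 'a) \<Rightarrow> (nat \<Rightarrow> real) \<Rightarrow> (nat \<Rightarrow> 'a) \<Rightarrow> bool" where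
  "AAP m g b x \<longleftrightarrow>
     (\<forall>t. \<exists>\<alpha>. optimal_weights m g (x t) \<alpha> \<and>
        x (Suc t) = (1 - b t) *\<^sub>R (\<Sum>l\<le>m. \<alpha> l *\<^sub>R picard g (x t) l)
                    + b t *\<^sub>R (\<Sum>l\<le>m. \<alpha> l *\<^sub>R g (picard g (x t) l)))"

text \<open>The matrices \<open>S\<^sub>t\<close>, \<open>Y\<^sub>t\<close>, \<open>G\<^sub>t\<close> at the iterate \<open>x = x\<^sub>t\<close>.\<close>

definition S_mat :: "(real ^ 'd \<Rightarrow> real ^ 'd) \<Rightarrow> real ^ 'd \<Rightarrow> real ^ 'm::{finite,linorder} ^ 'd" where
  "S_mat g x = from_columns (\<lambda>l. picard g x (Suc l) - picard g x l)"

definition Y_mat :: "(real ^ 'd \<Rightarrow> real ^ 'd) \<Rightarrow> real ^ 'd \<Rightarrow> real ^ 'm::{finite,linorder} ^ 'd" where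
  "Y_mat g x = from_columns (\<lambda>l. residual g (picard g x (Suc l)) - residual g (picard g x l))"

definition G_mat :: "(real ^ 'd \<Rightarrow> real ^ 'd) \<Rightarrow> real ^ 'd \<Rightarrow> real ^ 'm::{finite,linorder} ^ 'd" where
  "G_mat g x = from_columns (\<lambda>l. matrix_power (jacobian g (at x)) l *v residual g x)"

end

theory Submission
  imports Defs
begin

text \<open>With \<open>B = g'(x\<^sup>*)\<close>, the \<open>l\<close>-th Picard iterate near \<open>x\<^sup>*\<close> has residual \<open>B\<^sup>l f\<^sub>t\<close> up to an
  error of order \<open>\<parallel>f\<^sub>t\<parallel>\<^sup>2\<close>. The lower bound on the smallest singular value of \<open>Y\<^sub>t\<close> keeps the optimal
  weights bounded, so the step multiplies the minimal combined residual by at most \<open>(1 - \<beta>) + \<beta>\<kappa>\<close>,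
  again up to quadratic terms. Minimality compares that residual with \<open>p(A) f\<^sub>t\<close> for any fixed \<open>p\<close> of
  degree at most \<open>m\<close> with \<open>p(0) = 1\<close>, since \<open>p(A) = p(B - I)\<close> is an affine combination of powers of
  \<open>B\<close>. The error constant depends on \<open>p\<close>, but by compactness of the sphere finitely many \<open>p\<close> suffice.
  In the symmetric case \<open>A\<close> is necessarily negative definite because \<open>\<parallel>B\<parallel> \<le> \<kappa> < 1\<close>, and a rescaled
  Chebyshev polynomial is small on its spectrum.\<close>

section \<open>Symmetric operators and singular values\<close>

text \<open>For small negative \<open>h\<close> the linear term dominates the quadratic one. This
  serves as the first-order condition at a minimiser.\<close>

lemma quadratic_nonneg_imp_linear_coeff_nonpos:
  fixes a q :: real
  assumes "\<And>h. 0 \<le> 2 * h * a + h\<^sup>2 * q"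
  shows "a \<le> 0"
proof (rule ccontr)
  assume "\<not> a \<le> 0"
  define h where "h = a / (\<bar>q\<bar> + 1)"
  have h: "h > 0" "h * (\<bar>q\<bar> + 1) = a"
    using \<open>\<not> a \<le> 0\<close> by (auto simp: h_def)
  have "0 \<le> h * (h * q - 2 * a)"
    using assms[of "- h"] by (simp add: power2_eq_square algebra_simps)
  then have "2 * a \<le> h * q"
    using h by (simp add: zero_le_mult_iff)
  also have "\<dots> \<le> h * (\<bar>q\<bar> + 1)"
    using h by (intro mult_left_mono) auto
  finally show False
    using h \<open>\<not> a \<le> 0\<close> by simp
qed

text \<open>The Rayleigh quotient attains its minimum on the unit sphere of \<open>U\<close>, and
  stationarity there is the eigenvalue equation. Invariance of \<open>U\<close> keeps the test
  direction inside \<open>U\<close>.\<close>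

lemma symmetric_min_eigenvector:
  fixes F :: "'a::euclidean_space \<Rightarrow> 'a"
  assumes lin: "linear F" and sym: "\<And>v w. v \<bullet> F w = F v \<bullet> w"
    and U: "subspace U" "F ` U \<subseteq> U" "U \<noteq> {0}"
  obtains u \<mu> where "u \<in> U" "norm u = 1" "F u = \<mu> *\<^sub>R u"
    "\<And>w. w \<in> U \<Longrightarrow> \<mu> * (norm w)\<^sup>2 \<le> w \<bullet> F w"
proof -
  let ?S = "U \<inter> sphere 0 1"
  have unit: "w /\<^sub>R norm w \<in> ?S" if "w \<in> U" "w \<noteq> 0" for w
    using that U(1) by (auto simp: subspace_scale)
  have "compact ?S"
    using U(1) by (simp add: closed_subspace closed_Int_compact)
  moreover have "?S \<noteq> {}"
    using U(1,3) unit subspace_0 by blast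
  moreover have "continuous_on ?S (\<lambda>w. w \<bullet> F w)"
    by (intro continuous_intros linear_continuous_on_compose[OF _ lin])
  ultimately have "\<exists>u\<in>?S. \<forall>w\<in>?S. u \<bullet> F u \<le> w \<bullet> F w"
    by (rule continuous_attains_inf)
  then obtain u where u: "u \<in> ?S" "\<And>w. w \<in> ?S \<Longrightarrow> u \<bullet> F u \<le> w \<bullet> F w"
    by blast
  define \<mu> where "\<mu> = u \<bullet> F u"
  have ge: "\<mu> * (norm w)\<^sup>2 \<le> w \<bullet> F w" if "w \<in> U" for w
  proof (cases "w = 0")
    case False
    have "\<mu> \<le> (w /\<^sub>R norm w) \<bullet> F (w /\<^sub>R norm w)"
      unfolding \<mu>_def using unit[OF that False] by (rule u(2))
    also have "\<dots> = (w \<bullet> F w) / (norm w)\<^sup>2"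
      by (simp add: linear_scale[OF lin] power2_eq_square divide_inverse)
    finally show ?thesis
      using False by (simp add: pos_le_divide_eq)
  qed (simp add: linear_0[OF lin])
  \<comment> \<open>\<open>z\<close> is the defect of the eigenvalue equation. Perturbing
    \<open>u\<close> in this very direction makes \<open>z \<bullet> z\<close> the linear
    coefficient, which forces it to vanish.\<close>
  define z where "z = F u - \<mu> *\<^sub>R u"
  have uU: "u \<in> U" and u1: "u \<bullet> u = 1"
    using u(1) by (auto simp: norm_eq_1)
  have zU: "z \<in> U"
    unfolding z_def using U uU by (auto intro!: subspace_diff subspace_scale)
  have "0 \<le> 2 * h * (z \<bullet> z) + h\<^sup>2 * (z \<bullet> F z - \<mu> * (z \<bullet> z))" for h
  proof -
    have uz: "u \<bullet> F z = z \<bullet> F u"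
      by (metis inner_commute sym)
    have "u + h *\<^sub>R z \<in> U"
      using U(1) uU zU by (simp add: subspace_add subspace_scale)
    from ge[OF this]
    have "0 \<le> (u + h *\<^sub>R z) \<bullet> (F u + h *\<^sub>R F z) - \<mu> * ((u + h *\<^sub>R z) \<bullet> (u + h *\<^sub>R z))"
      by (simp add: linear_add[OF lin] linear_scale[OF lin] power2_norm_eq_inner)
    also have "\<dots> = (u \<bullet> F u - \<mu> * (u \<bullet> u)) + 2 * h * (z \<bullet> (F u - \<mu> *\<^sub>R u))
        + h\<^sup>2 * (z \<bullet> F z - \<mu> * (z \<bullet> z))"
      by (simp add: inner_add_left inner_add_right inner_diff_right uz inner_commute[of u z]
          power2_eq_square ring_distribs)
    also have "\<dots> = 2 * h * (z \<bullet> z) + h\<^sup>2 * (z \<bullet> F z - \<mu> * (z \<bullet> z))"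
      by (simp add: u1 flip: z_def \<mu>_def)
    finally show ?thesis .
  qed
  then have "z \<bullet> z \<le> 0"
    by (rule quadratic_nonneg_imp_linear_coeff_nonpos)
  then have "z = 0"
    by (metis inner_eq_zero_iff inner_ge_zero order_antisym)
  then show ?thesis
    using that[of u \<mu>] uU u1 ge by (simp add: z_def norm_eq_1)
qed

lemma eigenvectors_orthogonal:
  fixes F :: "'a::real_inner \<Rightarrow> 'a"
  assumes sym: "\<And>v w. v \<bullet> F w = F v \<bullet> w"
    and "F v = \<mu> *\<^sub>R v" "F w = \<nu> *\<^sub>R w" "\<mu> \<noteq> \<nu>"
  shows "orthogonal v w"
  using sym[of v w] assms(2-) by (simp add: orthogonal_def)

text \<open>One eigenvector per eigenvalue gives an orthogonal family, and such families are finite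
  in a Euclidean space. Finiteness is what gives \<open>Min\<close> and \<open>Max\<close> over the
  singular values their meaning.\<close>

lemma finite_eigenvalues:
  fixes F :: "'a::euclidean_space \<Rightarrow> 'a"
  assumes sym: "\<And>v w. v \<bullet> F w = F v \<bullet> w"
  shows "finite {\<mu>. \<exists>v. v \<noteq> 0 \<and> F v = \<mu> *\<^sub>R v}" (is "finite ?E")
proof -
  have "\<forall>\<mu>\<in>?E. \<exists>v. v \<noteq> 0 \<and> F v = \<mu> *\<^sub>R v"
    by blast
  then obtain v where v: "\<forall>\<mu>\<in>?E. v \<mu> \<noteq> 0 \<and> F (v \<mu>) = \<mu> *\<^sub>R v \<mu>"
    by metis
  have "inj_on v ?E"
    by (rule inj_onI) (metis v scaleR_right_imp_eq)
  moreover have "pairwise orthogonal (v ` ?E)"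
  proof (clarsimp simp: pairwise_def)
    fix \<mu> \<nu> a b
    assume "a \<noteq> 0" "F a = \<mu> *\<^sub>R a" "b \<noteq> 0" "F b = \<nu> *\<^sub>R b" "v \<mu> \<noteq> v \<nu>"
    then show "orthogonal (v \<mu>) (v \<nu>)"
      using v by (intro eigenvectors_orthogonal[OF sym, of _ \<mu> _ \<nu>]) auto
  qed
  ultimately show ?thesis
    using pairwise_orthogonal_imp_finite[of "v ` ?E"] by (simp add: finite_image_iff)
qed

text \<open>An orthonormal set of eigenvectors of greatest cardinality must span: otherwise its
  orthogonal complement is a nonzero invariant subspace and supplies one more eigenvector.\<close>

theorem symmetric_eigenbasis:
  fixes F :: "'a::euclidean_space \<Rightarrow> 'a"
  assumes lin: "linear F" and sym: "\<And>v w. v \<bullet> F w = F v \<bullet> w"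
  obtains E \<mu> where "finite E" "pairwise orthogonal E" "\<And>e. e \<in> E \<Longrightarrow> norm e = 1"
    "\<And>e. e \<in> E \<Longrightarrow> F e = \<mu> e *\<^sub>R e" "span E = UNIV"
proof -
  define P where
    "P E \<longleftrightarrow> pairwise orthogonal E \<and> (\<forall>e\<in>E. norm e = 1 \<and> (\<exists>\<mu>. F e = \<mu> *\<^sub>R e))" for E
  have ind: "independent E" if "P E" for E
    using that pairwise_orthogonal_independent[of E] by (force simp: P_def)
  have "P {}"
    by (simp add: P_def)
  moreover have "\<forall>E. P E \<longrightarrow> card E < Suc (DIM('a))"
    using ind independent_bound by (auto simp: less_Suc_eq_le)
  ultimately obtain E where E: "P E" "\<And>D. P D \<Longrightarrow> card D \<le> card E"
    using ex_has_greatest_nat[of P "{}" card] by blast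
  have fin: "finite E"
    using ind[OF E(1)] independent_bound by blast
  have "span E = UNIV"
  proof (rule ccontr)
    assume "span E \<noteq> UNIV"
    define U where "U = {y. \<forall>e\<in>E. orthogonal e y}"
    have sub: "subspace U"
      unfolding U_def by (auto simp: subspace_def orthogonal_def inner_right_distrib)
    have "F ` U \<subseteq> U"
    proof (clarsimp simp: U_def orthogonal_def)
      fix y e
      assume "\<forall>e\<in>E. e \<bullet> y = 0" "e \<in> E"
      moreover from this(2) obtain \<nu> where "F e = \<nu> *\<^sub>R e"
        using E(1) by (auto simp: P_def)
      ultimately show "e \<bullet> F y = 0"
        by (simp add: sym[of e])
    qed
    moreover have "U \<noteq> {0}"
    proof -
      have "span E \<subset> span UNIV"
        using \<open>span E \<noteq> UNIV\<close> by auto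
      from orthogonal_to_subspace_exists_gen[OF this]
      obtain y where "y \<noteq> 0" "\<And>e. e \<in> span E \<Longrightarrow> orthogonal y e"
        by blast
      then have "y \<in> U"
        by (simp add: U_def orthogonal_commute span_base)
      with \<open>y \<noteq> 0\<close> show ?thesis
        by blast
    qed
    ultimately obtain u \<nu> where u: "u \<in> U" "norm u = 1" "F u = \<nu> *\<^sub>R u"
      using symmetric_min_eigenvector[OF lin sym sub] by metis
    from u(1) have orth: "orthogonal e u" "orthogonal u e" if "e \<in> E" for e
      using that by (auto simp: U_def orthogonal_commute)
    have "P (insert u E)"
      using E(1) u(2,3) orth by (auto simp: P_def pairwise_insert)
    moreover have "u \<notin> E"
      using orth(1)[of u] u(2) by (auto simp: orthogonal_self)
    ultimately show False
      using E(2)[of "insert u E"] fin by simp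
  qed
  moreover obtain \<mu> where "\<And>e. e \<in> E \<Longrightarrow> F e = \<mu> e *\<^sub>R e"
    using E(1) unfolding P_def by metis
  ultimately show ?thesis
    using that[of E \<mu>] fin E(1) by (simp add: P_def)
qed

section \<open>Singular values through the Gram matrix\<close>

lemma inner_gram:
  fixes Y :: "real ^ 'm ^ 'd"
  shows "v \<bullet> ((transpose Y ** Y) *v w) = (Y *v v) \<bullet> (Y *v w)"
  by (metis dot_lmul_matrix inner_commute matrix_vector_mul_assoc transpose_matrix_vector)

lemma finite_singular_values:
  fixes Y :: "real ^ 'm ^ 'd"
  shows "finite (singular_values Y)"
proof -
  have "v \<bullet> ((transpose Y ** Y) *v w) = ((transpose Y ** Y) *v v) \<bullet> w" for v w
    by (metis inner_gram inner_commute)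
  then have "finite {\<mu>. \<exists>v. v \<noteq> 0 \<and> (transpose Y ** Y) *v v = \<mu> *\<^sub>R v}"
    by (rule finite_eigenvalues)
  moreover have "(\<lambda>\<sigma>. \<sigma>\<^sup>2) ` singular_values Y \<subseteq> {\<mu>. \<exists>v. v \<noteq> 0 \<and> (transpose Y ** Y) *v v = \<mu> *\<^sub>R v}"
    by (auto simp: singular_values_def)
  moreover have "inj_on (\<lambda>\<sigma>. \<sigma>\<^sup>2) (singular_values Y)"
    by (auto simp: inj_on_def singular_values_def)
  ultimately show ?thesis
    by (meson finite_imageD finite_subset)
qed

text \<open>The least eigenvalue \<open>\<mu>\<close> of the Gram matrix is the squared norm of
  \<open>Y *v u\<close> at a unit eigenvector \<open>u\<close>, so \<open>sqrt \<mu>\<close> is a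
  singular value. The Rayleigh bound for \<open>\<mu>\<close> is the desired inequality
  squared.\<close>

lemma exists_singular_value_le:
  fixes Y :: "real ^ 'm ^ 'd"
  obtains \<sigma> where "\<sigma> \<in> singular_values Y" "\<And>v. \<sigma> * norm v \<le> norm (Y *v v)"
proof -
  let ?F = "\<lambda>v. (transpose Y ** Y) *v v"
  have "UNIV \<noteq> {0 :: real ^ 'm}"
    by (rule UNIV_not_singleton)
  then obtain u \<mu> where u: "norm u = 1" "?F u = \<mu> *\<^sub>R u"
    and \<mu>: "\<And>w. \<mu> * (norm w)\<^sup>2 \<le> w \<bullet> ?F w"
    using symmetric_min_eigenvector[of ?F UNIV] by (auto simp: inner_gram inner_commute)
  have sq: "w \<bullet> ?F w = (norm (Y *v w))\<^sup>2" for w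
    by (simp add: inner_gram power2_norm_eq_inner)
  have "\<mu> = (norm (Y *v u))\<^sup>2"
    using u sq[of u] by (simp add: norm_eq_1)
  then have pos: "\<mu> \<ge> 0"
    by simp
  have "sqrt \<mu> \<in> singular_values Y"
    using u pos by (auto simp: singular_values_def intro!: exI[of _ u])
  moreover have "sqrt \<mu> * norm v \<le> norm (Y *v v)" for v
    by (rule power2_le_imp_le) (use \<mu>[of v] pos in \<open>auto simp: sq power_mult_distrib\<close>)
  ultimately show ?thesis
    using that by blast
qed

lemma sigma_min_mult_norm_le: "sigma_min Y * norm v \<le> norm (Y *v v)"
proof -
  obtain \<sigma> where \<sigma>: "\<sigma> \<in> singular_values Y" "\<And>v. \<sigma> * norm v \<le> norm (Y *v v)"
    by (rule exists_singular_value_le) blast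
  have "sigma_min Y * norm v \<le> \<sigma> * norm v"
    using \<sigma>(1) finite_singular_values[of Y] by (auto simp: sigma_min_def intro!: mult_right_mono Min_le)
  with \<sigma>(2) show ?thesis
    using order_trans by blast
qed

section \<open>Residual polynomials\<close>

lemma sum_matrix_vector_mult: "(\<Sum>i\<in>I. M i) *v v = (\<Sum>i\<in>I. M i *v v)"
  for M :: "'i \<Rightarrow> real ^ 'm ^ 'd"
  by (induction I rule: infinite_finite_induct) (simp_all add: matrix_vector_mult_add_rdistrib)

lemma matrix_poly_mult_vector:
  assumes "degree p \<le> n"
  shows "matrix_poly p A *v v = (\<Sum>k\<le>n. coeff p k *\<^sub>R (matrix_power A k *v v))"
proof -
  have "matrix_poly p A *v v = (\<Sum>k\<le>degree p. coeff p k *\<^sub>R (matrix_power A k *v v))"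
    by (simp add: matrix_poly_def sum_matrix_vector_mult scaleR_matrix_vector_assoc)
  also have "\<dots> = (\<Sum>k\<le>n. coeff p k *\<^sub>R (matrix_power A k *v v))"
    using assms by (intro sum.mono_neutral_left) (auto simp: coeff_eq_0)
  finally show ?thesis .
qed

lemma matrix_poly_eigenvector:
  assumes "A *v v = \<mu> *\<^sub>R v"
  shows "matrix_poly p A *v v = poly p \<mu> *\<^sub>R v"
proof -
  have "matrix_power A k *v v = \<mu> ^ k *\<^sub>R v" for k
    by (induction k) (simp_all add: assms matrix_vector_mult_scaleR mult.commute
        flip: matrix_vector_mul_assoc)
  then show ?thesis
    by (simp add: matrix_poly_mult_vector[OF order.refl] poly_altdef scaleR_sum_left)
qed

lemma symmetric_mat_inner:
  assumes "symmetric_mat A"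
  shows "v \<bullet> (A *v w) = (A *v v) \<bullet> w"
  using assms unfolding symmetric_mat_def by (metis dot_lmul_matrix transpose_matrix_vector)

text \<open>In an orthonormal eigenbasis the matrix polynomial multiplies each coordinate by a value
  of \<open>p\<close> at an eigenvalue, and Pythagoras adds up the coordinates.\<close>

lemma norm_matrix_poly_symmetric_le:
  fixes A :: "real ^ 'd ^ 'd"
  assumes A: "symmetric_mat A" and K: "0 \<le> K"
    and le: "\<And>\<mu> v. v \<noteq> 0 \<Longrightarrow> A *v v = \<mu> *\<^sub>R v \<Longrightarrow> \<bar>poly p \<mu>\<bar> \<le> K"
  shows "norm (matrix_poly p A *v v) \<le> K * norm v"
proof -
  obtain E \<mu> where E: "finite E" "pairwise orthogonal E" "\<And>e. e \<in> E \<Longrightarrow> norm e = 1"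
    "\<And>e. e \<in> E \<Longrightarrow> A *v e = \<mu> e *\<^sub>R e" "span E = UNIV"
    using symmetric_eigenbasis[of "\<lambda>v. A *v v"] symmetric_mat_inner[OF A]
    by (metis matrix_vector_mul_linear)
  have sq: "(norm (\<Sum>e\<in>E. c e *\<^sub>R e))\<^sup>2 = (\<Sum>e\<in>E. (c e)\<^sup>2)" for c
  proof -
    have "pairwise (\<lambda>i j. orthogonal (c i *\<^sub>R i) (c j *\<^sub>R j)) E"
      using E(2) by (simp add: pairwise_def orthogonal_clauses)
    then have "(norm (\<Sum>e\<in>E. c e *\<^sub>R e))\<^sup>2 = (\<Sum>e\<in>E. (norm (c e *\<^sub>R e))\<^sup>2)"
      using E(1) by (rule norm_sum_Pythagorean[rotated])
    also have "\<dots> = (\<Sum>e\<in>E. (c e)\<^sup>2)"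
      by (rule sum.cong) (simp_all add: E(3))
    finally show ?thesis .
  qed
  have v: "v = (\<Sum>e\<in>E. (v \<bullet> e) *\<^sub>R e)"
    using orthonormal_basis_expand[of E v] E by simp
  have "matrix_poly p A *v v = (\<Sum>e\<in>E. (v \<bullet> e) *\<^sub>R (matrix_poly p A *v e))"
    by (subst v) (simp add: matrix_vector_mult_scaleR linear_sum[OF matrix_vector_mul_linear])
  also have "\<dots> = (\<Sum>e\<in>E. ((v \<bullet> e) * poly p (\<mu> e)) *\<^sub>R e)"
    by (rule sum.cong) (simp_all add: matrix_poly_eigenvector[OF E(4)])
  finally have "(norm (matrix_poly p A *v v))\<^sup>2 = (\<Sum>e\<in>E. (v \<bullet> e)\<^sup>2 * (poly p (\<mu> e))\<^sup>2)"
    by (simp add: sq power_mult_distrib)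
  also have "\<dots> \<le> (\<Sum>e\<in>E. (v \<bullet> e)\<^sup>2 * K\<^sup>2)"
  proof (intro sum_mono mult_left_mono)
    fix e assume "e \<in> E"
    then have "\<bar>poly p (\<mu> e)\<bar> \<le> K"
      using le[of e "\<mu> e"] E(3)[of e] E(4)[of e] by fastforce
    then show "(poly p (\<mu> e))\<^sup>2 \<le> K\<^sup>2"
      using K by (simp add: abs_le_square_iff[symmetric])
  qed simp
  also have "\<dots> = (K * norm v)\<^sup>2"
    using sq[of "\<lambda>e. v \<bullet> e"] v by (simp add: power_mult_distrib flip: sum_distrib_right)
  finally show ?thesis
    by (rule power2_le_imp_le) (simp add: K)
qed

section \<open>Chebyshev polynomials of the first kind and the residual polynomial built from
  them\<close>

fun chebyshev :: "nat \<Rightarrow> real poly" where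
  "chebyshev 0 = 1"
| "chebyshev (Suc 0) = [:0, 1:]"
| "chebyshev (Suc (Suc n)) = [:0, 2:] * chebyshev (Suc n) - chebyshev n"

lemma degree_chebyshev_le: "degree (chebyshev n) \<le> n"
proof (induction n rule: chebyshev.induct)
  case (3 n)
  have "degree ([:0, 2:] * chebyshev (Suc n)) \<le> Suc (Suc n)"
    using 3(1) by (intro order.trans[OF degree_mult_le]) simp
  then show ?case
    using 3(2) by (auto intro!: degree_diff_le)
qed auto

lemma poly_chebyshev_cos: "poly (chebyshev n) (cos t) = cos (real n * t)"
proof (induction n rule: chebyshev.induct)
  case (3 n)
  have "cos (real (Suc (Suc n)) * t) + cos (real n * t) = 2 * cos t * cos (real (Suc n) * t)"
    using cos_add[of "real (Suc n) * t" t] cos_diff[of "real (Suc n) * t" t]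
    by (simp add: algebra_simps)
  then show ?case
    using 3 by simp
qed auto

lemma abs_poly_chebyshev_le_1:
  assumes "\<bar>x\<bar> \<le> 1"
  shows "\<bar>poly (chebyshev n) x\<bar> \<le> 1"
  using poly_chebyshev_cos[of n "arccos x"] assms by (simp add: cos_arccos_abs)

text \<open>This replaces the cosine formula outside [-1, 1]: \<open>r\<close> and \<open>c\<close>
  are the roots of z^2 - (r + c) z + 1, so their powers satisfy the Chebyshev recurrence.\<close>

lemma poly_chebyshev_joukowski:
  assumes "r * c = 1"
  shows "poly (chebyshev n) ((r + c) / 2) = (r ^ n + c ^ n) / 2"
proof (induction n rule: chebyshev.induct)
  case (3 n)
  have "(r + c) * (r * a + c * b) - (a + b) = r * r * a + c * c * b" for a b
    using assms by algebra
  from this[of "r ^ n" "c ^ n"] 3 show ?case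
    by (simp add: field_simps)
qed auto

text \<open>The affine map taking [-L, -l] onto [-1, 1] sends 0 to a = (L + l) / (L - l). Composing
  the Chebyshev polynomial with it and dividing by its value \<open>D\<close> at \<open>a\<close>
  gives a residual polynomial bounded by 1 / D on the interval.\<close>

lemma chebyshev_residual_poly:
  fixes l L :: real
  assumes l: "0 < l" "l \<le> L" and m: "m \<ge> 1"
  defines "\<rho> \<equiv> (sqrt (L / l) - 1) / (sqrt (L / l) + 1)"
  obtains p where "p \<in> residual_polys m" "\<And>\<mu>. - L \<le> \<mu> \<Longrightarrow> \<mu> \<le> - l \<Longrightarrow> \<bar>poly p \<mu>\<bar> \<le> 2 * \<rho> ^ m"
\<comment> \<open>In the degenerate case the affine map does not exist and \<open>\<rho>\<close> is
  0. A linear polynomial with its root at \<open>- l\<close> does the job, as \<open>m\<close> is at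
  least 1.\<close>
proof (cases "l = L")
  case True
  show ?thesis
  proof (rule that[of "[:1, 1 / l:]"])
    show "[:1, 1 / l:] \<in> residual_polys m"
      using m l by (simp add: residual_polys_def)
    show "\<bar>poly [:1, 1 / l:] \<mu>\<bar> \<le> 2 * \<rho> ^ m" if "- L \<le> \<mu>" "\<mu> \<le> - l" for \<mu>
    proof -
      have "\<mu> = - l"
        using that True by simp
      then show ?thesis
        using m l True by (simp add: \<rho>_def)
    qed
  qed
next
  case False
  define s where "s = sqrt (L / l)"
  define a where "a = (L + l) / (L - l)"
  \<comment> \<open>\<open>r\<close> is the reciprocal of \<open>\<rho>\<close> and solves (r + 1 /
    r) / 2 = a, so the value \<open>D\<close> becomes explicit in powers of
    \<open>r\<close>.\<close>
  define r where "r = (s + 1) / (s - 1)"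
  have lL: "l < L"
    using l False by simp
  have s: "s > 1" "s\<^sup>2 = L / l"
    using l lL by (auto simp: s_def)
  have r: "r > 1" "\<rho> = 1 / r"
    using s by (auto simp: r_def \<rho>_def simp flip: s_def)
  have "(r + 1 / r) / 2 = (s\<^sup>2 + 1) / (s\<^sup>2 - 1)"
  proof -
    have "r + 1 / r = ((s + 1) * (s + 1) + (s - 1) * (s - 1)) / ((s - 1) * (s + 1))"
      using s by (simp add: r_def add_frac_eq)
    also have "(s + 1) * (s + 1) + (s - 1) * (s - 1) = 2 * (s\<^sup>2 + 1)"
      by (simp add: power2_eq_square algebra_simps)
    also have "(s - 1) * (s + 1) = s\<^sup>2 - 1"
      by (simp add: power2_eq_square algebra_simps)
    finally have "r + 1 / r = 2 * ((s\<^sup>2 + 1) / (s\<^sup>2 - 1))"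
      by (simp only: times_divide_eq_right)
    then show ?thesis
      by (simp only: nonzero_mult_div_cancel_left[OF zero_neq_numeral[symmetric]])
  qed
  also have "\<dots> = a"
    using l lL by (simp add: s a_def divide_simps)
  finally have a: "(r + 1 / r) / 2 = a" .
  define D where "D = poly (chebyshev m) a"
  have D: "D = (r ^ m + 1 / r ^ m) / 2"
    using poly_chebyshev_joukowski[of r "1 / r" m] r by (simp add: D_def a power_one_over)
  have rm: "r ^ m > 0"
    using r by simp
  \<comment> \<open>Dropping the positive term 1 / r ^ m is where the factor 2 of the final bound
    comes from.\<close>
  then have Dge: "r ^ m / 2 \<le> D" "D > 0"
    by (auto simp: D field_simps intro!: add_pos_pos)
  define p where "p = smult (1 / D) (pcompose (chebyshev m) [:a, 2 / (L - l):])"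
  show ?thesis
  proof (rule that[of p])
    have "degree p \<le> m"
      unfolding p_def using degree_chebyshev_le[of m] lL
      by (intro order.trans[OF degree_smult_le]) (simp add: degree_pcompose)
    moreover have "poly p 0 = 1"
      using Dge by (simp add: p_def poly_pcompose D_def)
    ultimately show "p \<in> residual_polys m"
      by (simp add: residual_polys_def)
    show "\<bar>poly p \<mu>\<bar> \<le> 2 * \<rho> ^ m" if "- L \<le> \<mu>" "\<mu> \<le> - l" for \<mu>
    proof -
      have "a + \<mu> * (2 / (L - l)) = (L + l + 2 * \<mu>) / (L - l)"
        by (simp add: a_def add_divide_distrib)
      then have "\<bar>a + \<mu> * (2 / (L - l))\<bar> \<le> 1"
        using that lL by (simp add: abs_le_iff)
      then have "\<bar>poly p \<mu>\<bar> \<le> 1 / D"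
        using Dge by (simp add: p_def poly_pcompose abs_mult divide_right_mono abs_poly_chebyshev_le_1)
      also have "\<dots> \<le> 1 / (r ^ m / 2)"
        using Dge rm by (intro divide_left_mono) auto
      also have "\<dots> = 2 * \<rho> ^ m"
        by (simp add: r power_divide)
      finally show ?thesis .
    qed
  qed
qed

section \<open>Eigenvalues and singular values of negative definite matrices\<close>

lemma neg_def_eigenvalue_neg:
  assumes "pos_def_mat (- A)" "v \<noteq> 0" "A *v v = \<mu> *\<^sub>R v"
  shows "\<mu> < 0"
proof -
  have "0 < v \<bullet> ((- A) *v v)"
    using assms by (simp add: pos_def_mat_def)
  also have "\<dots> = - \<mu> * (v \<bullet> v)"
    using assms matrix_vector_mult_diff_rdistrib[of 0 A v] by simp
  finally show ?thesis
    using inner_ge_zero[of v] by (auto simp: mult_less_0_iff)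
qed

text \<open>By symmetry the Gram matrix is the square of \<open>A\<close>, with eigenvalue \<mu>^2
  at \<open>v\<close>; as \<open>\<mu>\<close> is negative, the nonnegative root is
  \<open>- \<mu>\<close>.\<close>

lemma neg_def_abs_eigenvalue_singular_value:
  assumes "symmetric_mat A" "pos_def_mat (- A)" "v \<noteq> 0" "A *v v = \<mu> *\<^sub>R v"
  shows "- \<mu> \<in> singular_values A"
  using neg_def_eigenvalue_neg[OF assms(2-)] assms
  by (auto simp: singular_values_def symmetric_mat_def power2_eq_square matrix_vector_mult_scaleR
      intro!: exI[of _ v] simp flip: matrix_vector_mul_assoc)

lemma singular_value_nonzero:
  assumes "pos_def_mat (- A)" "\<sigma> \<in> singular_values A"
  shows "\<sigma> \<noteq> 0"
proof
  assume "\<sigma> = 0"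
  with assms(2) obtain v where v: "v \<noteq> 0" "(transpose A ** A) *v v = 0"
    by (auto simp: singular_values_def)
  then have "A *v v = 0 *\<^sub>R v"
    using inner_gram[of v A v] by simp
  with neg_def_eigenvalue_neg[OF assms(1) v(1)] show False
    by blast
qed

lemma singular_values_nonempty: "singular_values Y \<noteq> {}"
  using exists_singular_value_le by blast

text \<open>A single Chebyshev polynomial bounds the inner infimum for all unit vectors at once,
  since the eigenvalues lie between \<open>- sigma_max A\<close> and
  \<open>- sigma_min A\<close>.\<close>

lemma max_inf_poly_neg_def_le:
  fixes A :: "real ^ 'd ^ 'd"
  assumes A: "symmetric_mat A" "pos_def_mat (- A)" and m: "m \<ge> 1"
  shows "max_inf_poly m A \<le> 2 * ((sqrt (cond2 A) - 1) / (sqrt (cond2 A) + 1)) ^ m"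
    (is "_ \<le> ?K")
proof -
  let ?V = "singular_values A"
  have V: "finite ?V" "?V \<noteq> {}"
    by (fact finite_singular_values singular_values_nonempty)+
  have "sigma_min A \<in> ?V"
    using V by (simp add: sigma_min_def)
  then have pos: "0 < sigma_min A"
    using singular_value_nonzero[OF A(2)] by (force simp: singular_values_def)
  have le: "sigma_min A \<le> sigma_max A"
    using V by (simp add: sigma_min_def sigma_max_def)
  obtain p where p: "p \<in> residual_polys m"
    "\<And>\<mu>. - sigma_max A \<le> \<mu> \<Longrightarrow> \<mu> \<le> - sigma_min A \<Longrightarrow> \<bar>poly p \<mu>\<bar> \<le> ?K"
    using chebyshev_residual_poly[OF pos le m] unfolding cond2_def by metis
  have ev: "\<bar>poly p \<mu>\<bar> \<le> ?K" if "v \<noteq> 0" "A *v v = \<mu> *\<^sub>R v" for v \<mu>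
  proof (rule p(2))
    have "- \<mu> \<in> ?V"
      using A that by (rule neg_def_abs_eigenvalue_singular_value)
    then have "sigma_min A \<le> - \<mu>" "- \<mu> \<le> sigma_max A"
      using V(1) by (simp_all add: sigma_min_def sigma_max_def)
    then show "- sigma_max A \<le> \<mu>" "\<mu> \<le> - sigma_min A"
      by simp_all
  qed
  have "0 \<le> ?K"
    using p(2)[of "- sigma_min A"] le by (smt (verit) abs_ge_zero)
  then have bd: "norm (matrix_poly p A *v v) \<le> ?K * norm v" for v
    by (rule norm_matrix_poly_symmetric_le[OF A(1)]) (use ev in blast)
  show ?thesis
    unfolding max_inf_poly_def
  proof (rule cSUP_least)
    fix v :: "real ^ 'd"
    assume "v \<in> sphere 0 1"
    moreover have "(INF p\<in>residual_polys m. norm (matrix_poly p A *v v)) \<le> norm (matrix_poly p A *v v)"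
      by (rule cINF_lower[OF _ p(1)]) (auto intro!: bdd_belowI[of _ 0])
    ultimately show "(INF p\<in>residual_polys m. norm (matrix_poly p A *v v)) \<le> ?K"
      using bd[of v] by simp
  qed simp
qed

section \<open>Linearisation of a contraction at its fixed point\<close>

text \<open>Mean value inequality on the ball around \<open>y\<close> through \<open>z\<close>,
  where the Jacobian differs from its value at \<open>y\<close> by at most
  \<open>\<gamma> * norm (z - y)\<close>.\<close>

lemma jacobian_linearization:
  fixes g :: "real ^ 'd \<Rightarrow> real ^ 'd"
  assumes diff: "\<And>z. g differentiable (at z)"
    and lip: "\<And>y z. opnorm2 (jacobian g (at y) - jacobian g (at z)) \<le> \<gamma> * norm (y - z)"
    and \<gamma>: "\<gamma> > 0"
  shows "norm (g z - g y - jacobian g (at y) *v (z - y)) \<le> \<gamma> * (norm (z - y))\<^sup>2"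
proof -
  let ?S = "cball y (norm (z - y))"
  let ?g' = "\<lambda>z h. jacobian g (at z) *v h"
  have der: "(g has_derivative ?g' w) (at w within ?S)" for w
    using diff[of w] by (auto simp: jacobian_works intro: has_derivative_at_withinI)
  have "norm (g z - g y - ?g' y (z - y)) \<le> norm (z - y) * (\<gamma> * norm (z - y))"
  proof (rule differentiable_bound_linearization[OF _ der])
    fix t :: real
    assume "t \<in> {0..1}"
    then show "y + t *\<^sub>R (z - y) \<in> ?S"
      by (auto simp: dist_norm mult_left_le_one_le)
  next
    fix w
    assume "w \<in> ?S"
    have "onorm (?g' w - ?g' y) = opnorm2 (jacobian g (at w) - jacobian g (at y))"
      by (simp add: opnorm2_def fun_diff_def matrix_vector_mult_diff_rdistrib)
    also have "\<dots> \<le> \<gamma> * norm (w - y)"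
      by (rule lip)
    also have "\<dots> \<le> \<gamma> * norm (z - y)"
      using \<open>w \<in> ?S\<close> \<gamma> by (intro mult_left_mono) (auto simp: dist_norm norm_minus_commute)
    finally show "onorm (?g' w - ?g' y) \<le> \<gamma> * norm (z - y)" .
  qed simp
  then show ?thesis
    by (simp add: power2_eq_square mult_ac)
qed

lemma jacobian_residual:
  fixes g :: "real ^ 'd \<Rightarrow> real ^ 'd"
  assumes "g differentiable (at z)"
  shows "jacobian (residual g) (at z) = jacobian g (at z) - mat 1"
proof -
  have "((\<lambda>x. g x - x) has_derivative (\<lambda>h. jacobian g (at z) *v h - h)) (at z)"
    using assms by (intro derivative_intros) (simp add: jacobian_works)
  then have "(residual g has_derivative (\<lambda>h. (jacobian g (at z) - mat 1) *v h)) (at z)"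
    by (simp add: residual_def[abs_def] matrix_vector_mult_diff_rdistrib)
  then show ?thesis
    by (metis frechet_derivative_at jacobian_def matrix_of_matrix_vector_mul)
qed

text \<open>The Jacobian at the fixed point enters only as a linear map \<open>B\<close>, and
  smoothness only through the quadratic remainder there, so the estimates below need no
  matrices.\<close>

locale smooth_contraction =
  fixes g B :: "'a::real_normed_vector \<Rightarrow> 'a" and xs :: 'a and \<kappa> \<gamma> :: real
  assumes linear_B: "linear B"
    and fixed: "g xs = xs"
    and lipschitz: "norm (g y - g z) \<le> \<kappa> * norm (y - z)"
    and \<kappa>: "0 \<le> \<kappa>" "\<kappa> < 1"
    and \<gamma>: "0 \<le> \<gamma>"
    and remainder: "norm (g z - xs - B (z - xs)) \<le> \<gamma> * (norm (z - xs))\<^sup>2"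
begin

definition R where "R z = g z - xs - B (z - xs)"

lemma norm_R_le: "norm (z - xs) \<le> e \<Longrightarrow> norm (R z) \<le> \<gamma> * e\<^sup>2"
  unfolding R_def using \<gamma>
  by (intro order.trans[OF remainder] mult_left_mono power_mono) auto

lemma norm_B_le: "norm (B v) \<le> \<kappa> * norm v"
proof (cases "v = 0")
  case False
  show ?thesis
  proof (rule field_le_epsilon)
    fix \<epsilon> :: real
    assume \<epsilon>: "\<epsilon> > 0"
    define N where "N = \<gamma> * (norm v)\<^sup>2"
    have N: "N \<ge> 0"
      using \<gamma> by (simp add: N_def)
    \<comment> \<open>The difference quotient with step \<open>h\<close> bounds
      \<open>norm (B v)\<close> up to an error \<open>h * N\<close>, which this choice keeps below
      \<open>\<epsilon>\<close>.\<close>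
    define h where "h = \<epsilon> / (N + 1)"
    have h: "h > 0"
      using \<epsilon> N by (simp add: h_def)
    have "h *\<^sub>R B v = (g (xs + h *\<^sub>R v) - g xs) - R (xs + h *\<^sub>R v)"
      by (simp add: R_def fixed linear_scale[OF linear_B])
    then have "norm (h *\<^sub>R B v) \<le> norm (g (xs + h *\<^sub>R v) - g xs) + norm (R (xs + h *\<^sub>R v))"
      by (metis norm_triangle_ineq4)
    also have "\<dots> \<le> \<kappa> * norm (h *\<^sub>R v) + \<gamma> * (norm (h *\<^sub>R v))\<^sup>2"
      using lipschitz[of "xs + h *\<^sub>R v" xs] norm_R_le[of "xs + h *\<^sub>R v"] by (intro add_mono) auto
    also have "\<dots> = h * (\<kappa> * norm v + h * N)"
      using h by (simp add: N_def power_mult_distrib power2_eq_square algebra_simps)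
    finally have "norm (B v) \<le> \<kappa> * norm v + h * N"
      using h by simp
    also have "h * N \<le> \<epsilon>"
      using \<epsilon> N by (simp add: h_def field_simps)
    finally show "norm (B v) \<le> \<kappa> * norm v + \<epsilon>"
      by simp
  qed
qed (simp add: linear_0[OF linear_B])

lemma norm_power_B_le: "norm ((B ^^ k) v) \<le> norm v"
proof (induction k)
  case (Suc k)
  have "norm (B ((B ^^ k) v)) \<le> \<kappa> * norm ((B ^^ k) v)"
    by (rule norm_B_le)
  also have "\<dots> \<le> norm ((B ^^ k) v)"
    using \<kappa> by (intro mult_left_le_one_le) auto
  finally show ?case
    using Suc by simp
qed simp

lemma norm_picard_le: "norm (picard g x l - xs) \<le> norm (x - xs)"
proof (induction l)
  case (Suc l)
  have "norm (g (picard g x l) - g xs) \<le> \<kappa> * norm (picard g x l - xs)"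
    by (rule lipschitz)
  also have "\<dots> \<le> norm (picard g x l - xs)"
    using \<kappa> by (intro mult_left_le_one_le) auto
  finally show ?case
    using Suc by (simp add: picard_def fixed)
qed (simp add: picard_def)

text \<open>As x - xs = (g x - g xs) - f(x), contraction absorbs the first difference. Errors
  quadratic in the distance to \<open>xs\<close> thereby become quadratic in the residual.\<close>

lemma norm_error_le_residual: "(1 - \<kappa>) * norm (x - xs) \<le> norm (residual g x)"
proof -
  have "norm (x - xs) \<le> norm (g x - g xs) + norm (residual g x)"
    using norm_triangle_ineq4[of "g x - g xs" "residual g x"] by (simp add: residual_def fixed)
  with lipschitz[of x xs] show ?thesis
    by (simp add: algebra_simps)
qed

lemma norm_residual_le: "norm (residual g x) \<le> 2 * norm (x - xs)"
proof -
  have "norm (residual g x) \<le> norm (g x - g xs) + norm (x - xs)"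
    using norm_triangle_ineq4[of "g x - g xs" "x - xs"] by (simp add: residual_def fixed)
  also have "norm (g x - g xs) \<le> 1 * norm (x - xs)"
    using \<kappa> by (intro order.trans[OF lipschitz] mult_right_mono) auto
  finally show ?thesis
    by simp
qed

lemma residual_expansion: "residual g z = B (z - xs) - (z - xs) + R z"
  by (simp add: residual_def R_def)

text \<open>Each Picard step adds two remainders, and \<open>B\<close> does not enlarge those
  already made; hence the factor \<open>2 * l\<close>.\<close>

lemma residual_picard_expansion:
  "norm (residual g (picard g x l) - (B ^^ l) (residual g x)) \<le> 2 * l * \<gamma> * (norm (x - xs))\<^sup>2"
proof (induction l)
  case (Suc l)
  let ?z = "picard g x l" and ?e = "norm (x - xs)"
  let ?d = "residual g ?z - (B ^^ l) (residual g x)"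
  have z: "picard g x (Suc l) = g ?z"
    by (simp add: picard_def)
  \<comment> \<open>Subtract the expansions of \<open>g\<close> around \<open>xs\<close> at
    \<open>?z\<close> and at \<open>g ?z\<close>.\<close>
  have "residual g (g ?z) = B (residual g ?z) + (R (g ?z) - R ?z)"
    by (simp add: residual_def R_def linear_diff[OF linear_B])
  then have "residual g (picard g x (Suc l)) - (B ^^ Suc l) (residual g x)
      = B ?d + (R (g ?z) - R ?z)"
    by (simp add: z linear_diff[OF linear_B])
  then have "norm (residual g (picard g x (Suc l)) - (B ^^ Suc l) (residual g x))
      = norm (B ?d + (R (g ?z) - R ?z))"
    by (rule arg_cong)
  also have "\<dots> \<le> norm (B ?d) + (norm (R (g ?z)) + norm (R ?z))"
    by (meson add_left_mono norm_triangle_ineq norm_triangle_ineq4 order_trans)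
  also have "\<dots> \<le> norm ?d + (\<gamma> * ?e\<^sup>2 + \<gamma> * ?e\<^sup>2)"
  proof (intro add_mono)
    show "norm (B ?d) \<le> norm ?d"
      using norm_power_B_le[of 1 ?d] by simp
    show "norm (R (g ?z)) \<le> \<gamma> * ?e\<^sup>2" "norm (R ?z) \<le> \<gamma> * ?e\<^sup>2"
      using norm_picard_le[of x l] norm_picard_le[of x "Suc l"] by (simp_all add: z norm_R_le)
  qed
  also have "\<dots> \<le> 2 * real l * \<gamma> * ?e\<^sup>2 + (\<gamma> * ?e\<^sup>2 + \<gamma> * ?e\<^sup>2)"
    by (intro add_right_mono Suc)
  also have "\<dots> = 2 * real (Suc l) * \<gamma> * ?e\<^sup>2"
    by (simp add: ring_distribs)
  finally show ?case .
qed (simp add: picard_def)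

lemma norm_weighted_sum_le:
  fixes v :: "nat \<Rightarrow> 'a"
  assumes "\<And>l. l \<le> m \<Longrightarrow> norm (v l) \<le> K" "(\<Sum>l\<le>m. \<bar>\<alpha> l\<bar>) \<le> W" "0 \<le> K"
  shows "norm (\<Sum>l\<le>m. \<alpha> l *\<^sub>R v l) \<le> W * K"
proof -
  have "norm (\<Sum>l\<le>m. \<alpha> l *\<^sub>R v l) \<le> (\<Sum>l\<le>m. \<bar>\<alpha> l\<bar> * K)"
    using assms(1) by (intro sum_norm_le) (simp add: mult_left_mono)
  also have "\<dots> \<le> W * K"
    using assms(2,3) by (simp add: mult_right_mono flip: sum_distrib_right)
  finally show ?thesis .
qed

text \<open>With \<open>X = \<Sum>l\<le>m. \<alpha> l *\<^sub>R picard g x l\<close> and \<open>F\<close> the combined residual, the new iterate is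
  \<open>X + b *\<^sub>R F\<close>, and linearising \<open>residual g\<close> there gives \<open>(1 - b) *\<^sub>R F + b *\<^sub>R B F\<close> up to
  quadratic terms.\<close>

lemma residual_step_le:
  fixes \<alpha> :: "nat \<Rightarrow> real" and x :: 'a and m :: nat
  defines "F \<equiv> \<Sum>l\<le>m. \<alpha> l *\<^sub>R residual g (picard g x l)"
  assumes \<alpha>: "(\<Sum>l\<le>m. \<alpha> l) = 1" and W: "(\<Sum>l\<le>m. \<bar>\<alpha> l\<bar>) \<le> W"
    and b: "0 \<le> b" "b \<le> 1"
    and y: "y = (1 - b) *\<^sub>R (\<Sum>l\<le>m. \<alpha> l *\<^sub>R picard g x l) + b *\<^sub>R (\<Sum>l\<le>m. \<alpha> l *\<^sub>R g (picard g x l))"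
  shows "norm (residual g y)
    \<le> ((1 - b) + b * \<kappa>) * norm F + (9 * W\<^sup>2 + W) * \<gamma> * (norm (x - xs))\<^sup>2"
proof -
  let ?e = "norm (x - xs)"
  define X where "X = (\<Sum>l\<le>m. \<alpha> l *\<^sub>R picard g x l)"
  define Q where "Q = (\<Sum>l\<le>m. \<alpha> l *\<^sub>R R (picard g x l))"
  have Xxs: "X - xs = (\<Sum>l\<le>m. \<alpha> l *\<^sub>R (picard g x l - xs))"
    using \<alpha> by (simp add: X_def scaleR_right_diff_distrib sum_subtractf flip: scaleR_sum_left)
  have "(\<Sum>l\<le>m. \<alpha> l *\<^sub>R g (picard g x l)) = F + X"
    by (simp add: F_def X_def residual_def scaleR_right_diff_distrib sum_subtractf)
  then have yF: "y = X + b *\<^sub>R F"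
    unfolding y X_def[symmetric] by (simp add: algebra_simps)
  have "B (X - xs) = (\<Sum>l\<le>m. \<alpha> l *\<^sub>R B (picard g x l - xs))"
    by (simp only: Xxs linear_sum[OF linear_B] linear_scale[OF linear_B])
  \<comment> \<open>The linear part of the residual at the mixed point \<open>X\<close> is thus
    \<open>F - Q\<close>, which can be substituted in the expansion at \<open>y\<close>.\<close>
  then have F: "F = B (X - xs) - (X - xs) + Q"
    unfolding F_def Q_def Xxs residual_expansion
    by (simp only: scaleR_add_right scaleR_right_diff_distrib sum.distrib sum_subtractf)
  have y_xs: "y - xs = (X - xs) + b *\<^sub>R F"
    by (simp add: yF)
  have "residual g y = (B (X - xs) - (X - xs)) + b *\<^sub>R (B F - F) + R y"
    unfolding residual_expansion y_xs linear_add[OF linear_B] linear_scale[OF linear_B]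
    by (simp add: algebra_simps)
  also have "\<dots> = (F - Q) + b *\<^sub>R (B F - F) + R y"
    using F by simp
  also have "\<dots> = ((1 - b) *\<^sub>R F + b *\<^sub>R B F) + (R y - Q)"
    by (simp add: algebra_simps)
  finally have "norm (residual g y) \<le> norm ((1 - b) *\<^sub>R F + b *\<^sub>R B F) + norm (R y - Q)"
    by (metis norm_triangle_ineq)
  also have "norm ((1 - b) *\<^sub>R F + b *\<^sub>R B F) \<le> norm ((1 - b) *\<^sub>R F) + norm (b *\<^sub>R B F)"
    by (rule norm_triangle_ineq)
  also have "\<dots> \<le> (1 - b) * norm F + b * (\<kappa> * norm F)"
    using b norm_B_le by (auto intro!: add_mono mult_left_mono)
  also have "norm (R y - Q) \<le> norm (R y) + norm Q"
    by (rule norm_triangle_ineq4)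
  \<comment> \<open>The 3 is 1 from the mixed iterates plus 2 from the combined residual; squared,
    it yields the 9 in the claim.\<close>
  also have "norm (R y) \<le> \<gamma> * (3 * W * ?e)\<^sup>2"
  proof (rule norm_R_le)
    have "norm (X - xs) \<le> W * ?e"
      unfolding Xxs by (rule norm_weighted_sum_le[OF norm_picard_le W]) simp
    moreover have "norm (residual g (picard g x l)) \<le> 2 * ?e" for l
      using norm_residual_le[of "picard g x l"] norm_picard_le[of x l] by linarith
    then have "norm F \<le> W * (2 * ?e)"
      unfolding F_def by (intro norm_weighted_sum_le[OF _ W]) auto
    moreover have "norm (b *\<^sub>R F) \<le> norm F"
      using b by (simp add: mult_left_le_one_le)
    ultimately show "norm (y - xs) \<le> 3 * W * ?e"
      unfolding y_xs using norm_triangle_ineq[of "X - xs" "b *\<^sub>R F"] by linarith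
  qed
  also have "norm Q \<le> W * (\<gamma> * ?e\<^sup>2)"
    unfolding Q_def using \<gamma> by (intro norm_weighted_sum_le norm_R_le norm_picard_le W) auto
  finally show ?thesis
    by (simp add: power_mult_distrib algebra_simps)
qed

text \<open>For competitor weights fixed in advance, the true residuals may be replaced by the
  vectors \<open>(B ^^ l) (residual g x)\<close> at quadratic cost.\<close>

lemma norm_combined_residual_le:
  fixes \<alpha> :: "nat \<Rightarrow> real"
  shows "norm (\<Sum>l\<le>m. \<alpha> l *\<^sub>R residual g (picard g x l))
    \<le> norm (\<Sum>l\<le>m. \<alpha> l *\<^sub>R (B ^^ l) (residual g x))
      + (\<Sum>l\<le>m. \<bar>\<alpha> l\<bar>) * (2 * m * \<gamma> * (norm (x - xs))\<^sup>2)"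
proof -
  let ?K = "2 * m * \<gamma> * (norm (x - xs))\<^sup>2"
  have "norm (residual g (picard g x l) - (B ^^ l) (residual g x)) \<le> ?K" if "l \<le> m" for l
    using that \<gamma>
    by (intro order.trans[OF residual_picard_expansion] mult_right_mono mult_left_mono) auto
  then have "norm (\<Sum>l\<le>m. \<alpha> l *\<^sub>R (residual g (picard g x l) - (B ^^ l) (residual g x)))
      \<le> (\<Sum>l\<le>m. \<bar>\<alpha> l\<bar>) * ?K"
    using \<gamma> by (intro norm_weighted_sum_le) auto
  then show ?thesis
    using norm_triangle_sub[of "\<Sum>l\<le>m. \<alpha> l *\<^sub>R residual g (picard g x l)"
        "\<Sum>l\<le>m. \<alpha> l *\<^sub>R (B ^^ l) (residual g x)"]
    by (simp add: scaleR_right_diff_distrib sum_subtractf)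
qed

end

section \<open>Weights of the alternating Anderson-Picard method\<close>

text \<open>\<open>from_columns\<close> numbers a column by its count of predecessors. That count is
  strictly increasing, hence injective, and equal cardinalities make it onto.\<close>

lemma bij_betw_card_lessThan:
  "bij_betw (\<lambda>j :: 'm::{finite,linorder}. card {..<j}) UNIV {..<CARD('m)}"
proof -
  have less: "card {..<i} < card {..<j}" if "i < j" for i j :: 'm
    using that by (intro psubset_card_mono) auto
  have inj: "inj (\<lambda>j :: 'm. card {..<j})"
    by (rule linorder_injI) (use less in fastforce)
  have "card {..<j} < CARD('m)" for j :: 'm
    by (intro psubset_card_mono) auto
  then have "range (\<lambda>j :: 'm. card {..<j}) \<subseteq> {..<CARD('m)}"
    by auto
  with inj show ?thesis
    by (simp add: bij_betw_def card_subset_eq card_image)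
qed

lemma from_columns_mult_vector:
  fixes c :: "nat \<Rightarrow> real ^ 'd"
  defines "C \<equiv> from_columns c :: real ^ 'm::{finite,linorder} ^ 'd"
  shows "C *v (\<chi> j. w (card {..<j})) = (\<Sum>i<CARD('m). w i *\<^sub>R c i)"
proof -
  have "C *v (\<chi> j. w (card {..<j})) = (\<Sum>j\<in>UNIV. w (card {..<j :: 'm}) *\<^sub>R c (card {..<j}))"
    by (simp add: C_def from_columns_def matrix_vector_mult_def vec_eq_iff mult.commute)
  also have "\<dots> = (\<Sum>i<CARD('m). w i *\<^sub>R c i)"
    by (rule sum.reindex_bij_betw[OF bij_betw_card_lessThan])
  finally show ?thesis .
qed

text \<open>Abel summation. For weights of sum 1 the tail sums are free coordinates with respect to
  the consecutive differences, which form the columns of \<open>Y_mat\<close>.\<close>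

lemma sum_scaleR_by_parts:
  fixes \<phi> :: "nat \<Rightarrow> 'a::real_vector"
  shows "(\<Sum>l\<le>m. \<alpha> l *\<^sub>R \<phi> l)
    = (\<Sum>l\<le>m. \<alpha> l) *\<^sub>R \<phi> 0 + (\<Sum>i<m. (\<Sum>l\<in>{i<..m}. \<alpha> l) *\<^sub>R (\<phi> (Suc i) - \<phi> i))"
proof (induction m)
  case (Suc m)
  have "(\<Sum>l\<in>{i<..Suc m}. \<alpha> l) = (\<Sum>l\<in>{i<..m}. \<alpha> l) + \<alpha> (Suc m)" if "i \<le> m" for i
  proof -
    have "{i<..Suc m} = insert (Suc m) {i<..m}"
      using that by auto
    then show ?thesis
      by simp
  qed
  then have "(\<Sum>i<Suc m. (\<Sum>l\<in>{i<..Suc m}. \<alpha> l) *\<^sub>R (\<phi> (Suc i) - \<phi> i))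
      = (\<Sum>i<Suc m. (\<Sum>l\<in>{i<..m}. \<alpha> l) *\<^sub>R (\<phi> (Suc i) - \<phi> i))
        + \<alpha> (Suc m) *\<^sub>R (\<Sum>i<Suc m. \<phi> (Suc i) - \<phi> i)"
    by (simp add: scaleR_left_distrib sum.distrib scaleR_sum_right del: sum.lessThan_Suc)
  also have "(\<Sum>i<Suc m. \<phi> (Suc i) - \<phi> i) = \<phi> (Suc m) - \<phi> 0"
    by (rule sum_lessThan_telescope)
  finally show ?case
    using Suc by (simp add: algebra_simps)
qed simp

text \<open>The tail sums form a vector that \<open>Y\<close> maps to the combined residual minus
  \<open>\<phi> 0\<close>, of norm at most \<open>2 * norm (\<phi> 0)\<close>. The singular value
  bound scales with the same norm, which cancels, and the weights are differences of tail
  sums.\<close>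

lemma least_squares_weights_bounded:
  fixes \<phi> :: "nat \<Rightarrow> real ^ 'd" and \<alpha> :: "nat \<Rightarrow> real"
  defines "Y \<equiv> from_columns (\<lambda>l. \<phi> (Suc l) - \<phi> l) :: real ^ 'm::{finite,linorder} ^ 'd"
  assumes m: "m = CARD('m)" and \<alpha>: "(\<Sum>l\<le>m. \<alpha> l) = 1"
    and le: "norm (\<Sum>l\<le>m. \<alpha> l *\<^sub>R \<phi> l) \<le> norm (\<phi> 0)" and \<phi>: "\<phi> 0 \<noteq> 0"
    and M: "M > 0" "sigma_min Y \<ge> M * norm (\<phi> 0)" and l: "l \<le> m"
  shows "\<bar>\<alpha> l\<bar> \<le> 1 + 4 / M"
proof -
  define w where "w i = (\<Sum>l\<in>{i<..m}. \<alpha> l)" for i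
  let ?v = "\<chi> j :: 'm. w (card {..<j})"
  have "Y *v ?v = (\<Sum>i<m. w i *\<^sub>R (\<phi> (Suc i) - \<phi> i))"
    unfolding Y_def m by (rule from_columns_mult_vector)
  then have "Y *v ?v = (\<Sum>l\<le>m. \<alpha> l *\<^sub>R \<phi> l) - \<phi> 0"
    by (simp add: sum_scaleR_by_parts[of \<alpha>] \<alpha> w_def)
  then have "norm (Y *v ?v) \<le> 2 * norm (\<phi> 0)"
    using le norm_triangle_ineq4[of "\<Sum>l\<le>m. \<alpha> l *\<^sub>R \<phi> l" "\<phi> 0"] by simp
  moreover have "M * norm (\<phi> 0) * norm ?v \<le> sigma_min Y * norm ?v"
    using M by (intro mult_right_mono) auto
  ultimately have "norm (\<phi> 0) * (M * norm ?v) \<le> norm (\<phi> 0) * 2"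
    using sigma_min_mult_norm_le[of Y ?v] by (simp add: mult_ac)
  then have v: "norm ?v \<le> 2 / M"
    using \<phi> M by (simp add: field_simps)
  \<comment> \<open>For \<open>i \<ge> m\<close> the tail is empty; the index \<open>m\<close>
    itself is needed to bound the last weight.\<close>
  have w: "\<bar>w i\<bar> \<le> 2 / M" for i
  proof (cases "i < m")
    case True
    then have "i \<in> range (\<lambda>j :: 'm. card {..<j})"
      using bij_betw_imp_surj_on[OF bij_betw_card_lessThan[where 'm='m]] m by simp
    then obtain j :: 'm where "i = card {..<j}"
      by blast
    then show ?thesis
      using component_le_norm_cart[of ?v j] v by simp
  qed (use M in \<open>simp add: w_def\<close>)
  show ?thesis
  proof (cases l)
    case 0
    have "{..m} = insert 0 {0<..m}"
      by auto
    then have "\<alpha> 0 = 1 - w 0"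
      using \<alpha> by (simp add: w_def)
    then show ?thesis
      using w[of 0] M 0 by (simp add: abs_le_iff)
  next
    case (Suc k)
    have "{k<..m} = insert (Suc k) {Suc k<..m}"
      using l Suc by auto
    then have "\<alpha> l = w k - w l"
      by (simp add: w_def Suc)
    then show ?thesis
      using w[of k] w[of l] by (simp add: abs_le_iff)
  qed
qed

section \<open>Polynomials in \<open>B - mat 1\<close> as admissible weights, and a finite choice
  among them\<close>

lemma matrix_poly_pCons:
  "matrix_poly (pCons c q) A *v v = c *\<^sub>R v + A *v (matrix_poly q A *v v)"
proof -
  have "matrix_poly (pCons c q) A *v v
      = (\<Sum>k\<le>Suc (degree q). coeff (pCons c q) k *\<^sub>R (matrix_power A k *v v))"
    by (rule matrix_poly_mult_vector) (simp add: degree_pCons_le)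
  also have "\<dots> = c *\<^sub>R v + A *v (matrix_poly q A *v v)"
    by (simp add: sum.atMost_Suc_shift matrix_poly_mult_vector[OF order.refl] matrix_vector_mult_scaleR
        linear_sum[OF matrix_vector_mul_linear] matrix_vector_mul_assoc del: sum.atMost_Suc)
  finally show ?thesis .
qed

text \<open>The weights are the coefficients of p(z - 1) in powers of z, and their sum is the value
  at z = 1, that is, p(0). Residual polynomials therefore yield weights of sum 1.\<close>

lemma matrix_poly_shift:
  fixes B :: "real ^ 'd ^ 'd"
  assumes "degree p \<le> m"
  shows "\<exists>\<alpha>. (\<Sum>l\<le>m. \<alpha> l) = poly p 0 \<and>
    (\<forall>v. matrix_poly p (B - mat 1) *v v = (\<Sum>l\<le>m. \<alpha> l *\<^sub>R ((*v) B ^^ l) v))"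
  using assms
proof (induction m arbitrary: p)
  case 0
  then obtain c where "p = [:c:]"
    by (auto elim: degree_eq_zeroE)
  then show ?case
    by (intro exI[of _ "\<lambda>_. c"]) (simp add: matrix_poly_def scaleR_matrix_vector_assoc[symmetric])
next
  case (Suc m)
  obtain c q where p: "p = pCons c q"
    by (rule pCons_cases)
  then have "degree q \<le> m"
    using Suc.prems by (auto split: if_splits)
  from Suc.IH[OF this] obtain \<alpha> where \<alpha>: "(\<Sum>l\<le>m. \<alpha> l) = poly q 0"
    "\<And>v. matrix_poly q (B - mat 1) *v v = (\<Sum>l\<le>m. \<alpha> l *\<^sub>R ((*v) B ^^ l) v)"
    by blast
  \<comment> \<open>Coefficients of c + (z - 1) q(z - 1): the weights of \<open>q\<close> shifted up
    by one, with \<open>c\<close> in front, minus the unshifted ones. The cutoff removes the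
    arbitrary value of \<open>\<alpha>\<close> at \<open>Suc m\<close>.\<close>
  define \<beta> where "\<beta> l = (case l of 0 \<Rightarrow> c | Suc k \<Rightarrow> \<alpha> k) - (if l \<le> m then \<alpha> l else 0)" for l
  have split: "(\<Sum>l\<le>Suc m. \<beta> l *\<^sub>R \<phi> l) = c *\<^sub>R \<phi> 0 + (\<Sum>l\<le>m. \<alpha> l *\<^sub>R \<phi> (Suc l)) - (\<Sum>l\<le>m. \<alpha> l *\<^sub>R \<phi> l)"
    for \<phi> :: "nat \<Rightarrow> 'b::real_vector"
  proof -
    have "(\<Sum>l\<le>Suc m. (case l of 0 \<Rightarrow> c | Suc k \<Rightarrow> \<alpha> k) *\<^sub>R \<phi> l)
        = c *\<^sub>R \<phi> 0 + (\<Sum>l\<le>m. \<alpha> l *\<^sub>R \<phi> (Suc l))"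
      by (simp add: sum.atMost_Suc_shift del: sum.atMost_Suc)
    moreover have "(\<Sum>l\<le>Suc m. (if l \<le> m then \<alpha> l else 0) *\<^sub>R \<phi> l) = (\<Sum>l\<le>m. \<alpha> l *\<^sub>R \<phi> l)"
      by simp
    ultimately show ?thesis
      unfolding \<beta>_def scaleR_left_diff_distrib sum_subtractf by simp
  qed
  \<comment> \<open>With \<open>\<phi>\<close> constantly 1 the two sums over
    \<open>\<alpha>\<close> cancel and \<open>c\<close> remains.\<close>
  have "(\<Sum>l\<le>Suc m. \<beta> l) = poly p 0"
    using split[of "\<lambda>_. 1 :: real"] by (simp add: p \<alpha>(1))
  moreover have "matrix_poly p (B - mat 1) *v v = (\<Sum>l\<le>Suc m. \<beta> l *\<^sub>R ((*v) B ^^ l) v)" for v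
    unfolding split p matrix_poly_pCons \<alpha>(2) matrix_vector_mult_diff_rdistrib
    by (simp add: linear_sum[OF matrix_vector_mul_linear] matrix_vector_mult_scaleR)
  ultimately show ?case
    by blast
qed

text \<open>A polynomial that is good at one unit vector is good on a neighbourhood, and the sphere
  is compact. Finiteness of \<open>P\<close> later permits one error constant for all steps.\<close>

lemma max_inf_poly_finite_cover:
  fixes A :: "real ^ 'd ^ 'd"
  assumes "\<epsilon> > 0"
  obtains P where "finite P" "P \<subseteq> residual_polys m"
    "\<And>v. norm v = 1 \<Longrightarrow> \<exists>p\<in>P. norm (matrix_poly p A *v v) < max_inf_poly m A + \<epsilon>"
proof -
  let ?U = "\<lambda>p. {v. norm (matrix_poly p A *v v) < max_inf_poly m A + \<epsilon>}"
  have "\<exists>p\<in>residual_polys m. v \<in> ?U p" if "norm v = 1" for v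
  proof -
    have "(INF p\<in>residual_polys m. norm (matrix_poly p A *v v)) \<le> max_inf_poly m A"
      using max_inf_poly_attained[of A m] that by metis
    also have "\<dots> < max_inf_poly m A + \<epsilon>"
      using assms by simp
    finally show ?thesis
      by (subst (asm) cINF_less_iff) (auto simp: residual_polys_def intro!: bdd_belowI[of _ 0] exI[of _ 1])
  qed
  then have cover: "sphere 0 1 \<subseteq> (\<Union>p\<in>residual_polys m. ?U p)"
    by auto
  have "open (?U p)" for p
    by (intro open_Collect_less continuous_intros)
  then obtain P where "P \<subseteq> residual_polys m" "finite P" "sphere 0 1 \<subseteq> (\<Union>p\<in>P. ?U p)"
    by (rule compactE_image[OF compact_sphere _ cover])
  then show ?thesis
    by (intro that[of P]) (auto simp: subset_iff)
qed

lemma optimal_weights_norm_le: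
  assumes "optimal_weights m g x \<alpha>" "(\<Sum>l\<le>m. w l) = 1"
  shows "norm (\<Sum>l\<le>m. \<alpha> l *\<^sub>R residual g (picard g x l))
    \<le> norm (\<Sum>l\<le>m. w l *\<^sub>R residual g (picard g x l))"
proof (rule power2_le_imp_le)
  have "\<forall>w. (\<Sum>l\<le>m. w l) = 1 \<longrightarrow> (norm (\<Sum>l\<le>m. \<alpha> l *\<^sub>R residual g (picard g x l)))\<^sup>2
      \<le> (norm (\<Sum>l\<le>m. w l *\<^sub>R residual g (picard g x l)))\<^sup>2"
    using assms(1) by (simp add: optimal_weights_def is_arg_min_linorder)
  with assms(2) show "(norm (\<Sum>l\<le>m. \<alpha> l *\<^sub>R residual g (picard g x l)))\<^sup>2
      \<le> (norm (\<Sum>l\<le>m. w l *\<^sub>R residual g (picard g x l)))\<^sup>2"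
    by blast
qed simp

text \<open>At a fixed point the Picard iterates are stationary and the matrix is zero, of rank 0.
  This keeps the denominators of the residual ratios nonzero.\<close>

lemma full_column_rank_S_mat_imp_residual_nonzero:
  assumes "full_column_rank (S_mat g x :: real ^ 'm::{finite,linorder} ^ 'd)"
  shows "residual g x \<noteq> 0"
proof
  assume "residual g x = 0"
  then have "picard g x l = x" for l
    by (induction l) (auto simp: picard_def residual_def)
  then have "(S_mat g x :: real ^ 'm::{finite,linorder} ^ 'd) = 0"
    by (simp add: S_mat_def from_columns_def vec_eq_iff)
  then show False
    using assms by (simp add: full_column_rank_def)
qed

section \<open>Asymptotic residual ratio from bounded weights, linearisation and the polynomial
  cover\<close>

theorem corollary5p6:
  fixes g :: "real ^ 'd \<Rightarrow> real ^ 'd"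
    and x :: "nat \<Rightarrow> real ^ 'd"
    and xs :: "real ^ 'd"
    and b :: "nat \<Rightarrow> real"
    and m :: nat
    and \<beta> \<kappa> \<gamma> T M T' M' :: real
    and S Y G :: "nat \<Rightarrow> real ^ 'm::{finite,linorder} ^ 'd"
  defines "f \<equiv> residual g"
    and "J \<equiv> \<lambda>t. jacobian (residual g) (at (x t))"
    and "S \<equiv> \<lambda>t. S_mat g (x t)"
    and "Y \<equiv> \<lambda>t. Y_mat g (x t)"
    and "G \<equiv> \<lambda>t. G_mat g (x t)"
    and "A \<equiv> jacobian (residual g) (at xs)"
  assumes m: "m = CARD('m::{finite,linorder})" "m \<le> CARD('d)"
    and g_diff: "\<And>z. g differentiable (at z)"
    and g_C1: "continuous_on UNIV (\<lambda>z. jacobian g (at z))"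
    and g_lipschitz: "\<And>y z. norm (g y - g z) \<le> \<kappa> * norm (y - z)"
    and \<kappa>: "\<kappa> < 1"
    and g'_lipschitz: "\<And>y z. opnorm2 (jacobian g (at y) - jacobian g (at z)) \<le> \<gamma> * norm (y - z)"
    and \<gamma>: "\<gamma> > 0"
    and AAP: "AAP m g b x"
    and \<beta>: "\<beta> > 0"
    and damping: "\<And>t. \<beta> \<le> b t" "\<And>t. b t \<le> 1"
    and rank_S: "\<And>t. full_column_rank (S t)"
    and rank_Y: "\<And>t. full_column_rank (Y t)"
    and T: "T > 0" and M: "M > 0"
    and cond_S: "\<And>t. real t > T \<Longrightarrow> cond2 (S t) \<le> M"
    and T': "T' > 0" and M': "M' > 0"
    and J_invertible: "\<And>t. real t \<ge> T' \<Longrightarrow> invertible (J t)"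
    and sigma_Y: "\<And>t. real t \<ge> T' \<Longrightarrow> sigma_min (Y t) \<ge> M' * norm (f (x t))"
    and rank_JG: "\<And>t. real t \<ge> T' \<Longrightarrow> full_column_rank (J t ** G t)"
    and fixed_point: "xs = g xs"
    and f_to_0: "(\<lambda>t. norm (f (x t))) \<longlonglongrightarrow> 0"
  shows "limsup (\<lambda>t. ereal (norm (f (x (Suc t))) / norm (f (x t))))
           \<le> ereal (((1 - \<beta>) + \<beta> * \<kappa>) * max_inf_poly m A)
       \<and> (symmetric_mat A \<and> (pos_def_mat A \<or> pos_def_mat (- A)) \<longrightarrow>
           limsup (\<lambda>t. ereal (norm (f (x (Suc t))) / norm (f (x t))))
             \<le> ereal (2 * ((1 - \<beta>) + \<beta> * \<kappa>)
                 * ((sqrt (cond2 A) - 1) / (sqrt (cond2 A) + 1)) ^ m))"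
proof -
  define Bm where "Bm = jacobian g (at xs)"
  have A: "A = Bm - mat 1"
    unfolding A_def Bm_def by (rule jacobian_residual[OF g_diff])
  \<comment> \<open>The Lipschitz bound at two points at distance 1 shows that
    \<open>\<kappa>\<close> is nonnegative.\<close>
  have "0 \<le> \<kappa> * norm (axis undefined 1 :: real ^ 'd)"
    using order_trans[OF norm_ge_zero g_lipschitz[of "axis undefined 1" 0]] by simp
  then have "0 \<le> \<kappa>"
    by simp
  then interpret smooth_contraction g "(*v) Bm" xs \<kappa> \<gamma>
  proof unfold_locales
    show "norm (g z - xs - Bm *v (z - xs)) \<le> \<gamma> * (norm (z - xs))\<^sup>2" for z
      using jacobian_linearization[OF g_diff g'_lipschitz \<gamma>, of z xs]
      by (simp add: Bm_def flip: fixed_point)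
  qed (use fixed_point g_lipschitz \<kappa> \<gamma> in
      \<open>auto simp: matrix_vector_right_distrib matrix_vector_mult_scaleR\<close>)
  define \<mu> where "\<mu> = max_inf_poly m A"
  define n where "n t = norm (f (x t))" for t
  define c where "c = (1 - \<beta>) + \<beta> * \<kappa>"
  \<comment> \<open>\<open>W\<close> bounds the absolute sum of the \<open>m + 1\<close> weights;
    \<open>C\<close> is the error constant of \<open>residual_step_le\<close> with the distance to
    \<open>xs\<close> expressed through the residual.\<close>
  define W where "W = (real m + 1) * (1 + 4 / M')"
  define C where "C = (9 * W\<^sup>2 + W) * \<gamma> / (1 - \<kappa>)\<^sup>2"
  have "\<beta> \<le> 1"
    using damping(1)[of 0] damping(2)[of 0] by linarith
  then have c: "0 \<le> c" "c \<le> 1"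
    using \<beta> \<open>0 \<le> \<kappa>\<close> \<kappa> by (auto simp: c_def mult_left_le)
  have W: "W \<ge> 0"
    using M' by (simp add: W_def)
  have n: "n t > 0" for t
    using full_column_rank_S_mat_imp_residual_nonzero rank_S[of t] by (auto simp: n_def f_def S_def)
  have n_lim: "n \<longlonglongrightarrow> 0"
    using f_to_0 by (simp add: n_def[abs_def])
  have error: "(norm (x t - xs))\<^sup>2 \<le> (n t)\<^sup>2 / (1 - \<kappa>)\<^sup>2" for t
  proof -
    have "norm (x t - xs) \<le> n t / (1 - \<kappa>)"
      using norm_error_le_residual[of "x t"] \<kappa> by (simp add: n_def f_def field_simps)
    then have "(norm (x t - xs))\<^sup>2 \<le> (n t / (1 - \<kappa>))\<^sup>2"
      by (rule power_mono) simp
    then show ?thesis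
      by (simp add: power_divide)
  qed
  from choice[OF AAP[unfolded AAP_def]] obtain \<alpha> where opt: "\<And>t. optimal_weights m g (x t) (\<alpha> t)"
    and step: "\<And>t. x (Suc t) = (1 - b t) *\<^sub>R (\<Sum>l\<le>m. \<alpha> t l *\<^sub>R picard g (x t) l)
      + b t *\<^sub>R (\<Sum>l\<le>m. \<alpha> t l *\<^sub>R g (picard g (x t) l))"
    by blast
  have \<alpha>1: "(\<Sum>l\<le>m. \<alpha> t l) = 1" for t
    using opt by (simp add: optimal_weights_def is_arg_min_linorder)
  define F where "F t = (\<Sum>l\<le>m. \<alpha> t l *\<^sub>R residual g (picard g (x t) l))" for t
  have F_le: "norm (F t) \<le> norm (\<Sum>l\<le>m. w l *\<^sub>R residual g (picard g (x t) l))"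
    if "(\<Sum>l\<le>m. w l) = 1" for t w
    unfolding F_def by (rule optimal_weights_norm_le[OF opt that])
  have \<alpha>_le: "(\<Sum>l\<le>m. \<bar>\<alpha> t l\<bar>) \<le> W" if "real t \<ge> T'" for t
  proof -
    \<comment> \<open>The competitor puts all weight on index 0.\<close>
    have "norm (F t) \<le> norm (residual g (picard g (x t) 0))"
      using F_le[of "\<lambda>l. if l = 0 then 1 else 0" t]
      by (simp add: if_distrib[of "\<lambda>a. a *\<^sub>R _"] cong: if_cong)
    then have "\<bar>\<alpha> t l\<bar> \<le> 1 + 4 / M'" if "l \<le> m" for l
      using n[of t] \<alpha>1 M' sigma_Y[OF \<open>real t \<ge> T'\<close>] that
      by (intro least_squares_weights_bounded[where 'm='m and \<phi>="\<lambda>l. residual g (picard g (x t) l)"])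
        (auto simp: m(1) F_def Y_def Y_mat_def n_def f_def picard_def)
    then have "(\<Sum>l\<le>m. \<bar>\<alpha> t l\<bar>) \<le> (\<Sum>l\<le>m. 1 + 4 / M')"
      by (intro sum_mono) simp
    then show ?thesis
      by (simp add: W_def algebra_simps)
  qed
  have next_le: "n (Suc t) \<le> c * norm (F t) + C * (n t)\<^sup>2" if "real t \<ge> T'" for t
  proof -
    have "n (Suc t) \<le> ((1 - b t) + b t * \<kappa>) * norm (F t) + (9 * W\<^sup>2 + W) * \<gamma> * (norm (x t - xs))\<^sup>2"
      unfolding n_def f_def F_def using damping[of t] \<beta>
      by (intro residual_step_le \<alpha>1 \<alpha>_le[OF that] step) auto
    also have "\<dots> \<le> c * norm (F t) + (9 * W\<^sup>2 + W) * \<gamma> * ((n t)\<^sup>2 / (1 - \<kappa>)\<^sup>2)"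
    proof (intro add_mono mult_right_mono mult_left_mono error)
      \<comment> \<open>The factor equals 1 - (1 - \<kappa>) b and so decreases in the damping
        ratio.\<close>
      have "(1 - \<kappa>) * \<beta> \<le> (1 - \<kappa>) * b t"
        using damping(1) \<kappa> by (intro mult_left_mono) auto
      then show "(1 - b t) + b t * \<kappa> \<le> c"
        by (simp add: c_def algebra_simps)
    qed (use W \<gamma> in auto)
    finally show ?thesis
      by (simp add: C_def)
  qed
  have poly_le: "\<exists>K\<ge>0. \<forall>t. norm (F t) \<le> norm (matrix_poly p A *v f (x t)) + K * (n t)\<^sup>2"
    if p: "p \<in> residual_polys m" for p
  proof -
    obtain w where w: "(\<Sum>l\<le>m. w l) = 1"
      "\<And>v. matrix_poly p A *v v = (\<Sum>l\<le>m. w l *\<^sub>R ((*v) Bm ^^ l) v)"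
      using matrix_poly_shift[of p m Bm] p by (auto simp: residual_polys_def A)
    define K where "K = (\<Sum>l\<le>m. \<bar>w l\<bar>) * (2 * m * \<gamma>)"
    have K: "K \<ge> 0"
      using \<gamma> by (auto simp: K_def intro!: mult_nonneg_nonneg sum_nonneg)
    have "norm (F t) \<le> norm (matrix_poly p A *v f (x t)) + K / (1 - \<kappa>)\<^sup>2 * (n t)\<^sup>2" for t
    proof -
      have "norm (F t) \<le> norm (matrix_poly p A *v f (x t)) + K * (norm (x t - xs))\<^sup>2"
        using order_trans[OF F_le[OF w(1)] norm_combined_residual_le]
        by (simp add: w(2) f_def K_def mult_ac)
      also have "\<dots> \<le> norm (matrix_poly p A *v f (x t)) + K * ((n t)\<^sup>2 / (1 - \<kappa>)\<^sup>2)"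
        by (intro add_left_mono mult_left_mono error K)
      finally show ?thesis
        by simp
    qed
    then show ?thesis
      using K by (intro exI[of _ "K / (1 - \<kappa>)\<^sup>2"]) auto
  qed
  have ratio: "limsup (\<lambda>t. ereal (n (Suc t) / n t)) \<le> ereal (c * \<mu>)"
  proof (rule ereal_le_epsilon2)
    fix \<epsilon> :: real
    assume "\<epsilon> > 0"
    then have \<epsilon>: "\<epsilon> / 2 > 0"
      by simp
    \<comment> \<open>One half of \<open>\<epsilon>\<close> pays for the choice of polynomial, the
      other for the terms that vanish with \<open>n t\<close>.\<close>
    obtain P where P: "finite P" "P \<subseteq> residual_polys m"
      "\<And>v. norm v = 1 \<Longrightarrow> \<exists>p\<in>P. norm (matrix_poly p A *v v) < \<mu> + \<epsilon> / 2"
      unfolding \<mu>_def using max_inf_poly_finite_cover[OF \<epsilon>, of m A] by blast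
    obtain K where K: "\<And>p. p \<in> P \<Longrightarrow> K p \<ge> 0"
      "\<And>p t. p \<in> P \<Longrightarrow> norm (F t) \<le> norm (matrix_poly p A *v f (x t)) + K p * (n t)\<^sup>2"
      using poly_le P(2) by (metis subsetD)
    define D where "D = sum K P"
    have F_ratio: "norm (F t) \<le> (\<mu> + \<epsilon> / 2 + D * n t) * n t" for t
    proof -
      \<comment> \<open>The polynomial is chosen for the direction of the residual and may change
        with \<open>t\<close>; the sum \<open>D\<close> of all constants covers every
        choice.\<close>
      let ?v = "f (x t) /\<^sub>R n t"
      have fx: "f (x t) = n t *\<^sub>R ?v"
        using n[of t] by simp
      have "norm ?v = 1"
        using n[of t] by (simp add: n_def)
      then obtain p where p: "p \<in> P" "norm (matrix_poly p A *v ?v) < \<mu> + \<epsilon> / 2"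
        using P(3) by blast
      have "norm (matrix_poly p A *v f (x t)) = n t * norm (matrix_poly p A *v ?v)"
        using n[of t] by (subst fx) (simp add: matrix_vector_mult_scaleR)
      also have "\<dots> \<le> n t * (\<mu> + \<epsilon> / 2)"
        using n[of t] p(2) by simp
      finally have "norm (F t) \<le> n t * (\<mu> + \<epsilon> / 2) + K p * (n t)\<^sup>2"
        using K(2)[OF p(1), of t] by linarith
      also have "K p * (n t)\<^sup>2 \<le> D * (n t)\<^sup>2"
        unfolding D_def using P(1) p(1) K(1) by (intro mult_right_mono member_le_sum) auto
      finally show ?thesis
        by (simp add: power2_eq_square algebra_simps)
    qed
    have "(\<lambda>t. (D + C) * n t) \<longlonglongrightarrow> (D + C) * 0"
      by (intro tendsto_intros n_lim)
    then have "eventually (\<lambda>t. (D + C) * n t < \<epsilon> / 2) sequentially"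
      using \<epsilon> by (intro order_tendstoD(2)) auto
    moreover have "eventually (\<lambda>t. real t \<ge> T') sequentially"
      using eventually_ge_at_top[of "nat \<lceil>T'\<rceil>"] by eventually_elim linarith
    ultimately have "eventually (\<lambda>t. ereal (n (Suc t) / n t) \<le> ereal (c * \<mu> + \<epsilon>)) sequentially"
    proof eventually_elim
      case (elim t)
      have "n (Suc t) \<le> c * norm (F t) + C * (n t)\<^sup>2"
        by (rule next_le) fact
      also have "\<dots> \<le> c * ((\<mu> + \<epsilon> / 2 + D * n t) * n t) + C * (n t)\<^sup>2"
        by (intro add_right_mono mult_left_mono F_ratio c)
      finally have "n (Suc t) \<le> (c * \<mu> + c * (\<epsilon> / 2 + D * n t) + C * n t) * n t"
        by (simp add: power2_eq_square algebra_simps)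
      then have "n (Suc t) / n t \<le> c * \<mu> + c * (\<epsilon> / 2 + D * n t) + C * n t"
        using n[of t] by (simp add: divide_le_eq)
      also have "c * (\<epsilon> / 2 + D * n t) \<le> 1 * (\<epsilon> / 2 + D * n t)"
        using c \<epsilon> n[of t] K(1) by (intro mult_right_mono) (auto simp: D_def intro!: add_nonneg_nonneg mult_nonneg_nonneg sum_nonneg)
      finally show ?case
        using elim(1) by (simp add: algebra_simps)
    qed
    then show "limsup (\<lambda>t. ereal (n (Suc t) / n t)) \<le> ereal (c * \<mu>) + ereal \<epsilon>"
      by (simp add: Limsup_bounded)
  qed
  \<comment> \<open>For a unit vector v, v . A v = v . Bm v - 1 \<le> \<kappa> - 1 < 0, so of the
    two sign alternatives the negative definite one remains.\<close>
  have "\<not> pos_def_mat A"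
  proof
    let ?v = "axis undefined 1 :: real ^ 'd"
    assume "pos_def_mat A"
    then have "0 < ?v \<bullet> (A *v ?v)"
      by (simp add: pos_def_mat_def)
    also have "?v \<bullet> (A *v ?v) = ?v \<bullet> (Bm *v ?v) - 1"
      by (simp add: A matrix_vector_mult_diff_rdistrib inner_diff_right inner_axis_axis)
    also have "?v \<bullet> (Bm *v ?v) \<le> norm ?v * norm (Bm *v ?v)"
      by (rule norm_cauchy_schwarz)
    finally show False
      using norm_B_le[of ?v] \<kappa> by simp
  qed
  moreover have "m \<ge> 1"
    by (simp add: m(1) Suc_le_eq)
  ultimately have "\<mu> \<le> 2 * ((sqrt (cond2 A) - 1) / (sqrt (cond2 A) + 1)) ^ m"
    if "symmetric_mat A" "pos_def_mat A \<or> pos_def_mat (- A)"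
    unfolding \<mu>_def using that by (intro max_inf_poly_neg_def_le) auto
  then have "ereal (c * \<mu>) \<le> ereal (2 * c * ((sqrt (cond2 A) - 1) / (sqrt (cond2 A) + 1)) ^ m)"
    if "symmetric_mat A" "pos_def_mat A \<or> pos_def_mat (- A)"
    using mult_left_mono[OF _ c(1)] that by (simp add: mult.left_commute mult.assoc)
  with ratio show ?thesis
    unfolding n_def \<mu>_def c_def using order_trans by blast
qed

end
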